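(* Assume that, for each $n\in\mathbb{N}_0$, the $m$-variate real stochastic processes $\{\mathbf{V}_{n1}(\varphi;t),\varphi\in[0,\pi],t\in\mathbb{T}\}$ and $\{\mathbf{V}_{n2}(\varphi;t),\varphi\in[0,\pi],t\in\mathbb{T}\}$ have mean $\mathbf{0}$ and covariance matrix function $\mathbf{B}_n(\varphi_1,\varphi_2;t)$, and that all the processes $\{\mathbf{V}_{n1}(\varphi;t),\varphi\in[0,\pi],t\in\mathbb{T}\}$ and $\{\mathbf{V}_{n2}(\varphi;t),\varphi\in[0,\pi],t\in\mathbb{T}\}$, $n\in\mathbb{N}_0$, are independent. If $\sum_{n=0}^\infty\mathbf{B}_n(\varphi_1,\varphi_2;t)$ converges, then $$\mathbf{Z}(\varphi,\theta;t)=\sum_{n=0}^\infty\left(\mathbf{V}_{n1}(\varphi;t)\cos(n\theta)+\mathbf{V}_{n2}(\varphi;t)\sin(n\theta)\right),\qquad \varphi\in[0,\pi],\ \theta\in[0,2\pi],\ t\in\mathbb{T},$$ is an $m$-variate random field longitudinally reversible on $\mathbb{S}^2$ and stationary on $\mathbb{T}$, with mean $\mathbf{0}$ and covariance matrix function $$\mathbf{C}(\varphi_1,\varphi_2,\theta;t)=\sum_{n=0}^\infty\mathbf{B}_n(\varphi_1,\varphi_2;t)\cos(n\theta),\qquad \varphi_1,\varphi_2\in[0,\pi],\ \theta\in[-2\pi,2\pi],\ t\in\mathbb{T}.$$ Moreover, $\mathbf{Z}(\varphi,\theta;t)$ is Gaussian if and only if all $\mathbf{V}_{n1}(\varphi;t)$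 and $\mathbf{V}_{n2}(\varphi;t)$ ($n\in\mathbb{N}_0$) are Gaussian.
   Context: $\mathbb{N}_0$ is the set of nonnegative integers; a prime denotes matrix transpose; the temporal domain is $\mathbb{T}=\mathbb{R}$ or $\mathbb{T}=\mathbb{Z}$. $\mathbb{S}^2$ is the unit sphere in $\mathbb{R}^3$; a point of $\mathbb{S}^2$ with longitude $\theta\in[0,2\pi]$ and latitude $\varphi\in[0,\pi]$ is designated $\mathbf{x}=(\varphi,\theta)$, and a random field on $\mathbb{S}^2\times\mathbb{T}$ is written in these coordinates as $\mathbf{Z}(\varphi,\theta;t)$. An $m$-variate real second-order random field on $\mathbb{S}^2\times\mathbb{T}$ is axially symmetric on $\mathbb{S}^2$ and stationary on $\mathbb{T}$ if its mean depends only on $\varphi$ and $\mathrm{cov}(\mathbf{Z}(\varphi_1,\theta_1;t_1),\mathbf{Z}(\varphi_2,\theta_2;t_2))$ depends only on $\varphi_1,\varphi_2,\theta_1-\theta_2,t_1-t_2$; this is then written $\mathbf{C}(\varphi_1,\varphi_2,\theta_1-\theta_2;t_1-t_2)$. Here $\mathrm{cov}(\mathbf{X},\mathbf{Y})=\mathrm{E}\{(\mathbf{X}-\mathrm{E}\mathbf{X})(\mathbf{Y}-\mathrm{E}\mathbf{Y})'\}$. It is longitudinally reversible on $\mathbb{S}^2$ if moreover $\mathbf{C}(\varphi_1,\varphi_2,-\theta;t)=\mathbf{C}(\varphi_1,\varphi_2,\theta;t)$ for all arguments. That a process $\mathbf{V}(\varphi;t)$ has covariance matrix function $\mathbf{B}_n(\varphi_1,\varphi_2;t)$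 means $\mathrm{cov}(\mathbf{V}(\varphi_1;t_1),\mathbf{V}(\varphi_2;t_2))=\mathbf{B}_n(\varphi_1,\varphi_2;t_1-t_2)$. Convergence of $\sum_n\mathbf{B}_n(\varphi_1,\varphi_2;t)$ is entrywise for all $\varphi_1,\varphi_2\in[0,\pi]$, $t\in\mathbb{T}$; the random series defining $\mathbf{Z}$ is understood in the mean square sense.
   Formalization: V_{02} is left out of the Gaussian equivalence, since it is multiplied by sin 0 = 0 and the literal "only if" fails for it; and agreement of Z at different longitudes of the same point is asserted only away from the poles, where the series may depend on θ. *)

theory Defs
  imports "HOL-Probability.Probability"
begin

definition second_order_field ::
  "'a measure \<Rightarrow> 'i set \<Rightarrow> ('i \<Rightarrow> 'a \<Rightarrow> real ^ 'm) \<Rightarrow> bool" where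
  "second_order_field M I X \<longleftrightarrow>
     (\<forall>i\<in>I. X i \<in> borel_measurable M \<and> integrable M (\<lambda>\<omega>. (norm (X i \<omega>))\<^sup>2))"

(* E{(X - EX)(Y - EY)'}, the expectation of a matrix being taken entrywise. *)
definition cov_matrix ::
  "'a measure \<Rightarrow> ('a \<Rightarrow> real ^ 'm) \<Rightarrow> ('a \<Rightarrow> real ^ 'm) \<Rightarrow> real ^ 'm ^ 'm" where
  "cov_matrix M X Y =
     (\<chi> i j. \<integral>\<omega>. (X \<omega> - integral\<^sup>L M X) $ i * (Y \<omega> - integral\<^sup>L M Y) $ j \<partial>M)"

(* Point masses count as normal, so that singular covariance matrices are allowed. *)
definition gaussian_var :: "'a measure \<Rightarrow> ('a \<Rightarrow> real) \<Rightarrow> bool" where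
  "gaussian_var M X \<longleftrightarrow> X \<in> borel_measurable M \<and>
     ((\<exists>\<mu>. AE \<omega> in M. X \<omega> = \<mu>) \<or>
      (\<exists>\<mu> \<sigma>. 0 < \<sigma> \<and> distributed M lborel X (normal_density \<mu> \<sigma>)))"

(* All finite-dimensional distributions are multivariate normal: every linear
   combination of finitely many components is normal. *)
definition gaussian_field ::
  "'a measure \<Rightarrow> 'i set \<Rightarrow> ('i \<Rightarrow> 'a \<Rightarrow> real ^ 'm) \<Rightarrow> bool" where
  "gaussian_field M I X \<longleftrightarrow>
     (\<forall>F a. finite F \<and> F \<subseteq> I \<longrightarrow> gaussian_var M (\<lambda>\<omega>. \<Sum>i\<in>F. a i \<bullet> X i \<omega>))"

definition independent_processes ::
  "'a measure \<Rightarrow> 'i set \<Rightarrow> ('k \<Rightarrow> 'i \<Rightarrow> 'a \<Rightarrow> real ^ 'm) \<Rightarrow> 'k set \<Rightarrow> bool" where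
  "independent_processes M I X K \<longleftrightarrow>
     prob_space.indep_vars M (\<lambda>_. PiM I (\<lambda>_. borel)) (\<lambda>k \<omega>. \<lambda>i\<in>I. X k i \<omega>) K"

(* The nonnegative integral, unlike the Bochner integral, does not vanish by
   convention when the square is not integrable. *)
definition mean_square_sums ::
  "'a measure \<Rightarrow> (nat \<Rightarrow> 'a \<Rightarrow> real ^ 'm) \<Rightarrow> ('a \<Rightarrow> real ^ 'm) \<Rightarrow> bool" where
  "mean_square_sums M X Y \<longleftrightarrow> Y \<in> borel_measurable M \<and>
     ((\<lambda>N. \<integral>\<^sup>+\<omega>. ennreal ((norm ((\<Sum>n<N. X n \<omega>) - Y \<omega>))\<^sup>2) \<partial>M) \<longlonglongrightarrow> 0)"

(* phi runs through [0, pi], measured from the pole (0, 0, 1). *)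
definition sphere_point :: "real \<Rightarrow> real \<Rightarrow> real ^ 3" where
  "sphere_point \<phi> \<theta> = vector [sin \<phi> * cos \<theta>, sin \<phi> * sin \<theta>, cos \<phi>]"

(* A field on the sphere, written in coordinates (phi, theta, t).  Two coordinate
   pairs of the same point carry almost surely equal values.  The poles are exempt:
   there the coordinates degenerate, and a series in cos (n theta), sin (n theta)
   with unrestricted coefficient processes does depend on theta. *)
definition sphere_time_field ::
  "'a measure \<Rightarrow> real set \<Rightarrow> (real \<times> real \<times> real \<Rightarrow> 'a \<Rightarrow> real ^ 'm) \<Rightarrow> bool" where
  "sphere_time_field M T Z \<longleftrightarrow>
     second_order_field M ({0..pi} \<times> {0..2*pi} \<times> T) Z \<and>
     (\<forall>\<phi>\<^sub>1\<in>{0<..<pi}. \<forall>\<phi>\<^sub>2\<in>{0<..<pi}. \<forall>\<theta>\<^sub>1\<in>{0..2*pi}. \<forall>\<theta>\<^sub>2\<in>{0..2*pi}. \<forall>t\<in>T.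
        sphere_point \<phi>\<^sub>1 \<theta>\<^sub>1 = sphere_point \<phi>\<^sub>2 \<theta>\<^sub>2 \<longrightarrow>
        (AE \<omega> in M. Z (\<phi>\<^sub>1, \<theta>\<^sub>1, t) \<omega> = Z (\<phi>\<^sub>2, \<theta>\<^sub>2, t) \<omega>))"

definition has_axial_covariance ::
  "'a measure \<Rightarrow> real set \<Rightarrow> (real \<times> real \<times> real \<Rightarrow> 'a \<Rightarrow> real ^ 'm) \<Rightarrow>
     (real \<Rightarrow> real \<Rightarrow> real \<Rightarrow> real \<Rightarrow> real ^ 'm ^ 'm) \<Rightarrow> bool" where
  "has_axial_covariance M T Z C \<longleftrightarrow>
     (\<forall>\<phi>\<^sub>1\<in>{0..pi}. \<forall>\<phi>\<^sub>2\<in>{0..pi}. \<forall>\<theta>\<^sub>1\<in>{0..2*pi}. \<forall>\<theta>\<^sub>2\<in>{0..2*pi}. \<forall>t\<^sub>1\<in>T. \<forall>t\<^sub>2\<in>T.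
        cov_matrix M (Z (\<phi>\<^sub>1, \<theta>\<^sub>1, t\<^sub>1)) (Z (\<phi>\<^sub>2, \<theta>\<^sub>2, t\<^sub>2)) = C \<phi>\<^sub>1 \<phi>\<^sub>2 (\<theta>\<^sub>1 - \<theta>\<^sub>2) (t\<^sub>1 - t\<^sub>2))"

definition axially_symmetric_stationary ::
  "'a measure \<Rightarrow> real set \<Rightarrow> (real \<times> real \<times> real \<Rightarrow> 'a \<Rightarrow> real ^ 'm) \<Rightarrow> bool" where
  "axially_symmetric_stationary M T Z \<longleftrightarrow>
     sphere_time_field M T Z \<and>
     (\<exists>\<mu>. \<forall>\<phi>\<in>{0..pi}. \<forall>\<theta>\<in>{0..2*pi}. \<forall>t\<in>T. integral\<^sup>L M (Z (\<phi>, \<theta>, t)) = \<mu> \<phi>) \<and>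
     (\<exists>C. has_axial_covariance M T Z C)"

(* For T = R or T = Z the function C is determined by Z on the quantified range,
   since differences of elements of [0, 2 pi] and of T fill [-2 pi, 2 pi] and T. *)
definition longitudinally_reversible_stationary ::
  "'a measure \<Rightarrow> real set \<Rightarrow> (real \<times> real \<times> real \<Rightarrow> 'a \<Rightarrow> real ^ 'm) \<Rightarrow> bool" where
  "longitudinally_reversible_stationary M T Z \<longleftrightarrow>
     axially_symmetric_stationary M T Z \<and>
     (\<exists>C. has_axial_covariance M T Z C \<and>
        (\<forall>\<phi>\<^sub>1\<in>{0..pi}. \<forall>\<phi>\<^sub>2\<in>{0..pi}. \<forall>\<theta>\<in>{-2*pi..2*pi}. \<forall>t\<in>T.
           C \<phi>\<^sub>1 \<phi>\<^sub>2 (-\<theta>) t = C \<phi>\<^sub>1 \<phi>\<^sub>2 \<theta> t))"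

definition is_longitude_series ::
  "'a measure \<Rightarrow> real set \<Rightarrow> (nat \<Rightarrow> nat \<Rightarrow> real \<times> real \<Rightarrow> 'a \<Rightarrow> real ^ 'm) \<Rightarrow>
     (real \<times> real \<times> real \<Rightarrow> 'a \<Rightarrow> real ^ 'm) \<Rightarrow> bool" where
  "is_longitude_series M T V Z \<longleftrightarrow>
     (\<forall>\<phi>\<in>{0..pi}. \<forall>\<theta>\<in>{0..2*pi}. \<forall>t\<in>T.
        mean_square_sums M
          (\<lambda>n \<omega>. cos (real n * \<theta>) *\<^sub>R V n 1 (\<phi>, t) \<omega> + sin (real n * \<theta>) *\<^sub>R V n 2 (\<phi>, t) \<omega>)
          (Z (\<phi>, \<theta>, t)))"

end

theory Submission
  imports Defs
begin

text \<open>
  Write \<open>S\<^sub>N\<close> for the partial sums of the series. Independence and \<open>cos a cos b + sin a sin b = cos (a - b)\<close>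
  give the covariances of the partial sums, so that convergence of the traces of \<open>B\<^sub>n(\<phi>, \<phi>; 0)\<close>
  makes \<open>S\<^sub>N\<close> a Cauchy sequence in \<open>L\<^sup>2\<close>; means and covariances pass to \<open>L\<^sup>2\<close> limits.

  Independent sums and \<open>L\<^sup>2\<close> limits of Gaussian variables are Gaussian, by characteristic functions. Hence \<open>Z\<close> is
  Gaussian if the coefficients are. Conversely, the coefficients are \<open>L\<^sup>2\<close> limits of finite linear
  combinations of values of \<open>Z\<close>: the discrete Fourier transform of \<open>Z\<close> on the grid \<open>2 \<pi> k / N\<close>
  recovers the coefficient of order \<open>n\<close> from \<open>S\<^bsub>N-n\<^esub>\<close> exactly, and the error coming from
  \<open>Z - S\<^bsub>N-n\<^esub>\<close> is bounded, uniformly over the grid, by a tail of the trace series.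
\<close>

section \<open>Mean square convergence\<close>

text \<open>The converse is shaped by what \<open>Z\<close> leaves open. Each value
  \<open>Z (\<phi>, \<theta>, t)\<close> is fixed only up to a null set that depends on the point,
  so integrating a path in \<theta> against a cosine may make no sense. Finite sums over a grid
  always do, and they are linear combinations of the kind that \<open>gaussian_field\<close> speaks
  of. The price is aliasing: on N grid points, orders n and m can interfere as soon as n + m reaches
  N, which is why the exact recovery is limited to the orders below N - n. The error is uniform over
  the grid because the cosine and sine coefficients of one order have the same covariance: the mean
  square of a block of terms is then free of \<theta>.

  Order 0 is special. Its sine term vanishes identically, so \<open>Z\<close> carries no information
  about \<open>V 0 2\<close>, and the Gaussian equivalence speaks of sine coefficients of positive
  order only.

  Variances may degenerate to 0 in a limit. Point masses count as Gaussian, and a characteristic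
  function written in terms of mean and variance covers them together with the normal
  densities.\<close>

definition square_integrable :: "'a measure \<Rightarrow> ('a \<Rightarrow> real) \<Rightarrow> bool" where
  "square_integrable M f \<longleftrightarrow> f \<in> borel_measurable M \<and> integrable M (\<lambda>x. (f x)\<^sup>2)"

text \<open>Square integrability is part of the notion because the Bochner integral of a
  non-integrable square is 0 by convention; the convergence alone could then hold for no good
  reason.\<close>

definition L2_limit :: "'a measure \<Rightarrow> (nat \<Rightarrow> 'a \<Rightarrow> real) \<Rightarrow> ('a \<Rightarrow> real) \<Rightarrow> bool" where
  "L2_limit M f g \<longleftrightarrow> (\<forall>n. square_integrable M (f n)) \<and> square_integrable M g \<and>
     (\<lambda>n. \<integral>x. (f n x - g x)\<^sup>2 \<partial>M) \<longlonglongrightarrow> 0"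

lemma square_integrable_measurable: "square_integrable M f \<Longrightarrow> f \<in> borel_measurable M"
  by (simp add: square_integrable_def)

lemma square_integrable_mult:
  assumes "square_integrable M f" "square_integrable M g"
  shows "integrable M (\<lambda>x. f x * g x)"
proof (rule Bochner_Integration.integrable_bound[where f = "\<lambda>x. (f x)\<^sup>2 + (g x)\<^sup>2"])
  have "\<bar>a * b\<bar> \<le> a\<^sup>2 + b\<^sup>2" for a b :: real
  proof -
    have "0 \<le> \<bar>a\<bar> * \<bar>b\<bar>" by simp
    then show ?thesis
      using sum_squares_bound[of "\<bar>a\<bar>" "\<bar>b\<bar>"]
      unfolding abs_mult power2_abs mult.assoc by linarith
  qed
  then show "AE x in M. norm (f x * g x) \<le> norm ((f x)\<^sup>2 + (g x)\<^sup>2)"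
    by auto
qed (use assms in \<open>auto simp: square_integrable_def\<close>)

lemma square_integrable_cmult:
  "square_integrable M f \<Longrightarrow> square_integrable M (\<lambda>x. c * f x)"
  by (auto simp: square_integrable_def power_mult_distrib)

lemma square_integrable_add:
  assumes "square_integrable M f" "square_integrable M g"
  shows "square_integrable M (\<lambda>x. f x + g x)"
  using assms square_integrable_mult[OF assms]
  by (auto simp: square_integrable_def power2_sum mult.assoc)

lemma square_integrable_diff:
  assumes "square_integrable M f" "square_integrable M g"
  shows "square_integrable M (\<lambda>x. f x - g x)"
  using square_integrable_add[OF assms(1) square_integrable_cmult[OF assms(2), of "-1"]] by simp

lemma square_integrable_sum:
  "(\<And>i. i \<in> F \<Longrightarrow> square_integrable M (f i)) \<Longrightarrow> square_integrable M (\<lambda>x. \<Sum>i\<in>F. f i x)"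
proof (induction F rule: infinite_finite_induct)
  case (insert i F)
  then show ?case by (simp add: square_integrable_add)
qed (auto simp: square_integrable_def)

lemma square_integrable_bound:
  assumes "f \<in> borel_measurable M" "square_integrable M g" "\<And>x. \<bar>f x\<bar> \<le> \<bar>g x\<bar>"
  shows "square_integrable M f"
  unfolding square_integrable_def
proof
  show "integrable M (\<lambda>x. (f x)\<^sup>2)"
    by (rule Bochner_Integration.integrable_bound[where f = "\<lambda>x. (g x)\<^sup>2"])
      (use assms in \<open>auto simp: square_integrable_def abs_le_square_iff\<close>)
qed (fact assms(1))

text \<open>The mean square of \<open>s * f x - r * g x\<close> is a nonnegative quadratic form in
  \<open>s\<close> and \<open>r\<close>. Keeping both free avoids a division: \<open>s = B\<close>
  and \<open>r = C\<close> turn it into \<open>B * (A * B - C\<^sup>2)\<close>, and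
  \<open>B = 0\<close> is treated apart.\<close>

lemma Cauchy_Schwarz_integral:
  assumes "square_integrable M f" "square_integrable M g"
  shows "(\<integral>x. f x * g x \<partial>M)\<^sup>2 \<le> (\<integral>x. (f x)\<^sup>2 \<partial>M) * (\<integral>x. (g x)\<^sup>2 \<partial>M)"
proof -
  define A where "A = (\<integral>x. (f x)\<^sup>2 \<partial>M)"
  define B where "B = (\<integral>x. (g x)\<^sup>2 \<partial>M)"
  define C where "C = (\<integral>x. f x * g x \<partial>M)"
  have [simp]: "integrable M (\<lambda>x. (f x)\<^sup>2)" "integrable M (\<lambda>x. (g x)\<^sup>2)"
    "integrable M (\<lambda>x. f x * g x)"
    using assms square_integrable_mult[OF assms] by (auto simp: square_integrable_def)
  have quad: "0 \<le> s\<^sup>2 * A - 2 * s * r * C + r\<^sup>2 * B" for s r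
  proof -
    have "0 \<le> (\<integral>x. (s * f x - r * g x)\<^sup>2 \<partial>M)"
      by simp
    also have "\<dots> = (\<integral>x. s\<^sup>2 * (f x)\<^sup>2 - 2 * s * r * (f x * g x) + r\<^sup>2 * (g x)\<^sup>2 \<partial>M)"
      by (intro Bochner_Integration.integral_cong) (auto simp: power2_eq_square algebra_simps)
    also have "\<dots> = s\<^sup>2 * A - 2 * s * r * C + r\<^sup>2 * B"
      by (simp add: A_def B_def C_def)
    finally show ?thesis .
  qed
  have B: "0 \<le> B" by (simp add: B_def)
  have "C\<^sup>2 \<le> A * B"
  proof (cases "B = 0")
    case True
    have "C = 0"
    proof (rule ccontr)
      assume "C \<noteq> 0"
      \<comment> \<open>For \<open>B = 0\<close> the form is affine in \<open>r\<close>; this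
        \<open>r\<close>, with \<open>s = 1\<close>, gives it the value -1.\<close>
      then have "2 * 1 * ((A + 1) / (2 * C)) * C = A + 1" by simp
      then show False
        using quad[of 1 "(A + 1) / (2 * C)"] True by simp
    qed
    then show ?thesis using True by simp
  next
    case False
    have "0 \<le> B * (A * B - C\<^sup>2)"
    proof -
      have "B\<^sup>2 * A - 2 * B * C * C + C\<^sup>2 * B = B * (A * B - C\<^sup>2)"
        by algebra
      then show ?thesis using quad[of B C] by simp
    qed
    then show ?thesis
      using B False by (simp add: zero_le_mult_iff)
  qed
  then show ?thesis by (simp add: A_def B_def C_def)
qed

lemma L2_limit_add:
  assumes "L2_limit M f g" "L2_limit M f' g'"
  shows "L2_limit M (\<lambda>n x. f n x + f' n x) (\<lambda>x. g x + g' x)"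
proof -
  let ?a = "\<lambda>n. \<integral>x. (f n x - g x)\<^sup>2 \<partial>M" and ?b = "\<lambda>n. \<integral>x. (f' n x - g' x)\<^sup>2 \<partial>M"
  have sq: "square_integrable M (\<lambda>x. f n x - g x)" "square_integrable M (\<lambda>x. f' n x - g' x)" for n
    using assms by (auto simp: L2_limit_def intro: square_integrable_diff)
  have "(\<lambda>n. 2 * ?a n + 2 * ?b n) \<longlonglongrightarrow> 2 * 0 + 2 * 0"
    using assms by (intro tendsto_intros) (auto simp: L2_limit_def)
  then have lim: "(\<lambda>n. 2 * ?a n + 2 * ?b n) \<longlonglongrightarrow> 0" by simp
  have "(\<lambda>n. \<integral>x. (f n x + f' n x - (g x + g' x))\<^sup>2 \<partial>M) \<longlonglongrightarrow> 0"
  proof (rule tendsto_sandwich[OF _ _ tendsto_const lim])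
    have "(\<integral>x. (f n x + f' n x - (g x + g' x))\<^sup>2 \<partial>M) \<le> 2 * ?a n + 2 * ?b n" for n
    proof -
      have "(\<integral>x. (f n x + f' n x - (g x + g' x))\<^sup>2 \<partial>M)
          \<le> (\<integral>x. 2 * (f n x - g x)\<^sup>2 + 2 * (f' n x - g' x)\<^sup>2 \<partial>M)"
      proof (rule integral_mono)
        show "integrable M (\<lambda>x. (f n x + f' n x - (g x + g' x))\<^sup>2)"
          using square_integrable_add[OF sq[of n]]
          by (simp add: square_integrable_def algebra_simps)
        show "integrable M (\<lambda>x. 2 * (f n x - g x)\<^sup>2 + 2 * (f' n x - g' x)\<^sup>2)"
          using sq by (simp add: square_integrable_def)
        show "(f n x + f' n x - (g x + g' x))\<^sup>2 \<le> 2 * (f n x - g x)\<^sup>2 + 2 * (f' n x - g' x)\<^sup>2" for x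
          using sum_squares_bound[of "f n x - g x" "f' n x - g' x"]
          by (simp add: power2_eq_square algebra_simps)
      qed
      also have "\<dots> = 2 * ?a n + 2 * ?b n"
        using sq by (simp add: square_integrable_def)
      finally show ?thesis .
    qed
    then show "\<forall>\<^sub>F n in sequentially. (\<integral>x. (f n x + f' n x - (g x + g' x))\<^sup>2 \<partial>M) \<le> 2 * ?a n + 2 * ?b n"
      by simp
  qed simp
  then show ?thesis
    using assms by (auto simp: L2_limit_def intro: square_integrable_add)
qed

lemma L2_limit_cmult:
  assumes "L2_limit M f g"
  shows "L2_limit M (\<lambda>n x. c * f n x) (\<lambda>x. c * g x)"
proof -
  have "(\<lambda>n. c\<^sup>2 * (\<integral>x. (f n x - g x)\<^sup>2 \<partial>M)) \<longlonglongrightarrow> c\<^sup>2 * 0"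
    using assms by (intro tendsto_intros) (auto simp: L2_limit_def)
  moreover have "(\<integral>x. (c * f n x - c * g x)\<^sup>2 \<partial>M) = c\<^sup>2 * (\<integral>x. (f n x - g x)\<^sup>2 \<partial>M)" for n
    by (simp flip: right_diff_distrib add: power_mult_distrib)
  ultimately show ?thesis
    using assms by (auto simp: L2_limit_def intro: square_integrable_cmult)
qed

lemma L2_limit_sum:
  "(\<And>i. i \<in> F \<Longrightarrow> L2_limit M (f i) (g i)) \<Longrightarrow>
    L2_limit M (\<lambda>n x. \<Sum>i\<in>F. f i n x) (\<lambda>x. \<Sum>i\<in>F. g i x)"
proof (induction F rule: infinite_finite_induct)
  case (insert i F)
  then show ?case by (simp add: L2_limit_add)
qed (auto simp: L2_limit_def square_integrable_def)

lemma L2_limit_const: "square_integrable M g \<Longrightarrow> L2_limit M (\<lambda>_. g) g"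
  by (simp add: L2_limit_def)

text \<open>The difference of the products is split as (f - g)(h - k) + (f - g) k + g (h - k), and
  Cauchy-Schwarz bounds each part. Taking \<open>h\<close> constantly 1 gives convergence of means,
  taking \<open>h = f\<close> that of second moments.\<close>

lemma L2_limit_integral_mult:
  assumes fg: "L2_limit M f g" and hk: "L2_limit M h k"
  shows "(\<lambda>n. \<integral>x. f n x * h n x \<partial>M) \<longlonglongrightarrow> (\<integral>x. g x * k x \<partial>M)"
proof -
  let ?a = "\<lambda>n. \<integral>x. (f n x - g x)\<^sup>2 \<partial>M" and ?b = "\<lambda>n. \<integral>x. (h n x - k x)\<^sup>2 \<partial>M"
  have sq: "square_integrable M (f n)" "square_integrable M g"
    "square_integrable M (h n)" "square_integrable M k"
    "square_integrable M (\<lambda>x. f n x - g x)" "square_integrable M (\<lambda>x. h n x - k x)" for n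
    using assms by (auto simp: L2_limit_def intro: square_integrable_diff)
  have lim0: "?a \<longlonglongrightarrow> 0" "?b \<longlonglongrightarrow> 0"
    using assms by (auto simp: L2_limit_def)
  have abs_le: "\<bar>\<integral>x. u x * v x \<partial>M\<bar> \<le> sqrt (\<integral>x. (u x)\<^sup>2 \<partial>M) * sqrt (\<integral>x. (v x)\<^sup>2 \<partial>M)"
    if "square_integrable M u" "square_integrable M v" for u v
    using real_sqrt_le_mono[OF Cauchy_Schwarz_integral[OF that]]
    by (simp add: real_sqrt_mult)
  define A where "A = sqrt (\<integral>x. (g x)\<^sup>2 \<partial>M)"
  define B where "B = sqrt (\<integral>x. (k x)\<^sup>2 \<partial>M)"
  let ?r = "\<lambda>n. sqrt (?a n) * sqrt (?b n) + sqrt (?a n) * B + A * sqrt (?b n)"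
  have "?r \<longlonglongrightarrow> sqrt 0 * sqrt 0 + sqrt 0 * B + A * sqrt 0"
    by (intro tendsto_intros lim0)
  then have lim: "?r \<longlonglongrightarrow> 0" by simp
  have le: "norm ((\<integral>x. f n x * h n x \<partial>M) - (\<integral>x. g x * k x \<partial>M)) \<le> ?r n" for n
  proof -
    have "(\<integral>x. f n x * h n x \<partial>M) - (\<integral>x. g x * k x \<partial>M) = (\<integral>x. f n x * h n x - g x * k x \<partial>M)"
      using sq by (intro Bochner_Integration.integral_diff[symmetric] square_integrable_mult)
    also have "\<dots> = (\<integral>x. (f n x - g x) * (h n x - k x) + (f n x - g x) * k x + g x * (h n x - k x) \<partial>M)"
      by (intro Bochner_Integration.integral_cong) (auto simp: algebra_simps)
    also have "\<dots> = (\<integral>x. (f n x - g x) * (h n x - k x) \<partial>M) + (\<integral>x. (f n x - g x) * k x \<partial>M)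
        + (\<integral>x. g x * (h n x - k x) \<partial>M)"
      using sq by (simp add: square_integrable_mult)
    finally show ?thesis
      using abs_le[OF sq(5) sq(6), of n n] abs_le[OF sq(5) sq(4), of n] abs_le[OF sq(2) sq(6), of n]
      unfolding A_def B_def by simp
  qed
  show ?thesis
    using le by (rule LIM_zero_cancel[OF Lim_null_comparison[OF always_eventually[OF allI] lim]])
qed

lemma (in prob_space) square_integrable_const: "square_integrable M (\<lambda>_. c)"
  by (simp add: square_integrable_def)

lemma (in prob_space) square_integrable_imp_integrable:
  "square_integrable M f \<Longrightarrow> integrable M f"
  using square_integrable_mult[OF _ square_integrable_const[of 1], of f] by simp

lemma (in prob_space) L2_limit_integral:
  "L2_limit M f g \<Longrightarrow> (\<lambda>n. \<integral>x. f n x \<partial>M) \<longlonglongrightarrow> (\<integral>x. g x \<partial>M)"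
  using L2_limit_integral_mult[OF _ L2_limit_const[OF square_integrable_const[of 1]], of f g]
  by simp

text \<open>The bridge from \<open>mean_square_sums\<close>, where the limit is only known to be
  measurable. A single finite distance already makes \<open>g\<close>, the difference of
  \<open>f n\<close> and \<open>f n - g\<close>, square integrable; from there on both kinds of
  integral agree.\<close>

lemma L2_limit_nn_integral:
  assumes f: "\<And>n. square_integrable M (f n)" and g: "g \<in> borel_measurable M"
    and lim: "(\<lambda>n. \<integral>\<^sup>+x. ennreal ((f n x - g x)\<^sup>2) \<partial>M) \<longlonglongrightarrow> 0"
  shows "L2_limit M f g"
proof -
  note [measurable] = g square_integrable_measurable[OF f]
  have "\<forall>\<^sub>F n in sequentially. (\<integral>\<^sup>+x. ennreal ((f n x - g x)\<^sup>2) \<partial>M) < 1"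
    using lim by (rule order_tendstoD) simp
  then obtain n where n: "(\<integral>\<^sup>+x. ennreal ((f n x - g x)\<^sup>2) \<partial>M) < 1"
    by (auto simp: eventually_sequentially)
  have "square_integrable M (\<lambda>x. f n x - g x)"
    unfolding square_integrable_def
    using n by (auto intro!: integrableI_nonneg intro: order.strict_trans)
  from square_integrable_diff[OF f[of n] this] have g2: "square_integrable M g"
    by simp
  have "(\<integral>\<^sup>+x. ennreal ((f n x - g x)\<^sup>2) \<partial>M) = ennreal (\<integral>x. (f n x - g x)\<^sup>2 \<partial>M)" for n
    using square_integrable_diff[OF f g2, of n]
    by (intro nn_integral_eq_integral) (auto simp: square_integrable_def)
  with lim have "(\<lambda>n. ennreal (\<integral>x. (f n x - g x)\<^sup>2 \<partial>M)) \<longlonglongrightarrow> ennreal 0"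
    by simp
  then have "(\<lambda>n. \<integral>x. (f n x - g x)\<^sup>2 \<partial>M) \<longlonglongrightarrow> 0"
    by (subst (asm) tendsto_ennreal_iff) auto
  then show ?thesis using f g2 by (simp add: L2_limit_def)
qed

text \<open>The Riesz-Fischer argument for vector-valued functions: a rapidly Cauchy subsequence
  converges almost everywhere, and Fatou's lemma along it bounds the distance of the whole sequence
  to the limit.\<close>

lemma L2_complete:
  fixes S :: "nat \<Rightarrow> 'a \<Rightarrow> 'b::{banach, second_countable_topology}"
  assumes S: "\<And>n. S n \<in> borel_measurable M"
    and Cauchy: "\<And>e. 0 < e \<Longrightarrow>
      \<exists>N. \<forall>m\<ge>N. \<forall>n\<ge>N. (\<integral>\<^sup>+x. ennreal ((norm (S m x - S n x))\<^sup>2) \<partial>M) \<le> ennreal e"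
    and fin: "finite_measure M"
  shows "\<exists>Y\<in>borel_measurable M. (\<lambda>n. \<integral>\<^sup>+x. ennreal ((norm (S n x - Y x))\<^sup>2) \<partial>M) \<longlonglongrightarrow> 0"
proof -
  interpret finite_measure M by (fact fin)
  note [measurable] = S
  let ?d = "\<lambda>m n. \<integral>\<^sup>+x. ennreal ((norm (S m x - S n x))\<^sup>2) \<partial>M"
  have "\<exists>N. \<forall>m\<ge>N. \<forall>n\<ge>N. ?d m n \<le> ennreal ((1/4)^k)" for k
    by (rule Cauchy) simp
  then obtain N where N: "\<And>k m n. N k \<le> m \<Longrightarrow> N k \<le> n \<Longrightarrow> ?d m n \<le> ennreal ((1/4)^k)"
    by metis
  \<comment> \<open>The sum puts both \<open>r k\<close> and \<open>r (Suc k)\<close> beyond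
    \<open>N k\<close>, so that consecutive terms of the subsequence are close; the summand
    \<open>k\<close> makes \<open>r\<close> unbounded, as the passage to the limit requires.\<close>
  define r where "r k = k + (\<Sum>j\<le>k. N j)" for k
  have rN: "N k \<le> r k" "k \<le> r k" "N k \<le> r (Suc k)" for k
    using member_le_sum[of k "{..k}" N] by (auto simp: r_def)
  (* The weights 2^k turn the bounds 4^-k on the squares into bounds on the increments themselves:
     |a| <= 2^-k + 2^k a^2. *)
  define D where "D k x = norm (S (r (Suc k)) x - S (r k) x)" for k x
  have D[measurable]: "D k \<in> borel_measurable M" for k
    unfolding D_def by measurable
  have "(\<integral>\<^sup>+x. (\<Sum>k. ennreal (2^k * (D k x)\<^sup>2)) \<partial>M) = (\<Sum>k. \<integral>\<^sup>+x. ennreal (2^k * (D k x)\<^sup>2) \<partial>M)"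
    by (rule nn_integral_suminf) measurable
  also have "\<dots> \<le> (\<Sum>k. ennreal ((1/2)^k))"
  proof (rule suminf_le)
    fix k
    have "(\<integral>\<^sup>+x. ennreal (2^k * (D k x)\<^sup>2) \<partial>M) = ennreal (2^k) * (\<integral>\<^sup>+x. ennreal ((D k x)\<^sup>2) \<partial>M)"
      by (subst nn_integral_cmult[symmetric]) (auto simp: ennreal_mult)
    also have "\<dots> \<le> ennreal (2^k) * ennreal ((1/4)^k)"
      unfolding D_def by (intro mult_left_mono N rN) auto
    also have "\<dots> = ennreal ((1/2)^k)"
      by (simp flip: ennreal_mult power_mult_distrib)
    finally show "(\<integral>\<^sup>+x. ennreal (2^k * (D k x)\<^sup>2) \<partial>M) \<le> ennreal ((1/2)^k)" .
  qed auto
  also have "\<dots> = ennreal (\<Sum>k. (1/2)^k)"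
    by (rule suminf_ennreal2) (auto intro: summable_geometric)
  finally have "(\<integral>\<^sup>+x. (\<Sum>k. ennreal (2^k * (D k x)\<^sup>2)) \<partial>M) \<noteq> \<infinity>"
    by (auto simp: top_unique)
  then have AE: "AE x in M. (\<Sum>k. ennreal (2^k * (D k x)\<^sup>2)) \<noteq> \<infinity>"
    by (intro nn_integral_PInf_AE) auto
  have conv: "convergent (\<lambda>k. S (r k) x)" if "(\<Sum>k. ennreal (2^k * (D k x)\<^sup>2)) \<noteq> \<infinity>" for x
  proof -
    have s1: "summable (\<lambda>k. 2^k * (D k x)\<^sup>2)"
      using that by (intro summable_suminf_not_top) auto
    have "summable (\<lambda>k. (1/2)^k + 2^k * (D k x)\<^sup>2)"
      by (intro summable_add s1 summable_geometric) auto
    then have "summable (\<lambda>k. S (r (Suc k)) x - S (r k) x)"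
    proof (rule summable_comparison_test'[where N = 0])
      fix k
      have "D k x \<le> (1/2)^k + 2^k * (D k x)\<^sup>2"
      proof (cases "D k x \<le> (1/2)^k")
        case True
        then show ?thesis by (simp add: add_increasing2)
      next
        case False
        then have "1 \<le> 2^k * D k x" by (simp add: field_simps)
        then have "1 * D k x \<le> 2^k * D k x * D k x"
          by (intro mult_right_mono) (auto simp: D_def)
        moreover have "(0::real) \<le> (1/2)^k" by simp
        ultimately show ?thesis
          unfolding power2_eq_square mult.assoc mult_1 by linarith
      qed
      then show "norm (S (r (Suc k)) x - S (r k) x) \<le> (1/2)^k + 2^k * (D k x)\<^sup>2"
        by (simp add: D_def)
    qed
    then have "convergent (\<lambda>n. \<Sum>k<n. S (r (Suc k)) x - S (r k) x)"
      by (simp add: summable_iff_convergent)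
    then have "convergent (\<lambda>n. S (r n) x - S (r 0) x)"
      by (simp add: sum_lessThan_telescope[of "\<lambda>k. S (r k) x"])
    then have "convergent (\<lambda>n. S (r n) x - S (r 0) x + S (r 0) x)"
      by (intro convergent_add convergent_const)
    then show ?thesis by simp
  qed
  define Y where "Y x = lim (\<lambda>k. S (r k) x)" for x
  have Y[measurable]: "Y \<in> borel_measurable M"
    unfolding Y_def by (rule borel_measurable_lim_metric) measurable
  have AE_lim: "AE x in M. (\<lambda>k. S (r k) x) \<longlonglongrightarrow> Y x"
    using AE by eventually_elim (use conv in \<open>auto simp: Y_def convergent_LIMSEQ_iff\<close>)
  have "(\<lambda>n. \<integral>\<^sup>+x. ennreal ((norm (S n x - Y x))\<^sup>2) \<partial>M) \<longlonglongrightarrow> 0"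
  proof (rule tendsto_zero_ennreal)
    fix e :: real assume "0 < e"
    \<comment> \<open>Fatou yields only a weak inequality, whereas a strict one is wanted; hence
      half of \<open>e\<close>.\<close>
    then obtain K where K: "\<And>m n. K \<le> m \<Longrightarrow> K \<le> n \<Longrightarrow> ?d m n \<le> ennreal (e / 2)"
      using Cauchy[of "e / 2"] by auto
    have "(\<integral>\<^sup>+x. ennreal ((norm (S n x - Y x))\<^sup>2) \<partial>M) < ennreal e" if n: "K \<le> n" for n
    proof -
      have "(\<integral>\<^sup>+x. ennreal ((norm (S n x - Y x))\<^sup>2) \<partial>M)
          = (\<integral>\<^sup>+x. liminf (\<lambda>k. ennreal ((norm (S n x - S (r k) x))\<^sup>2)) \<partial>M)"
      proof (rule nn_integral_cong_AE)
        show "AE x in M. ennreal ((norm (S n x - Y x))\<^sup>2)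
            = liminf (\<lambda>k. ennreal ((norm (S n x - S (r k) x))\<^sup>2))"
          using AE_lim
        proof eventually_elim
          case (elim x)
          then have "(\<lambda>k. ennreal ((norm (S n x - S (r k) x))\<^sup>2)) \<longlonglongrightarrow> ennreal ((norm (S n x - Y x))\<^sup>2)"
            by (intro tendsto_intros)
          then show ?case by (intro lim_imp_Liminf[symmetric]) auto
        qed
      qed
      also have "\<dots> \<le> liminf (\<lambda>k. ?d n (r k))"
        by (rule nn_integral_liminf) measurable
      also have "\<dots> \<le> limsup (\<lambda>k. ?d n (r k))"
        by (intro Liminf_le_Limsup sequentially_bot)
      also have "\<dots> \<le> ennreal (e / 2)"
      proof (rule Limsup_bounded)
        show "\<forall>\<^sub>F k in sequentially. ?d n (r k) \<le> ennreal (e / 2)"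
          unfolding eventually_sequentially
          by (intro exI[of _ K] allI impI K n) (use rN(2) order_trans in blast)
      qed
      also have "\<dots> < ennreal e" using \<open>0 < e\<close> by (simp add: ennreal_less_iff)
      finally show ?thesis .
    qed
    then show "\<forall>\<^sub>F n in sequentially. (\<integral>\<^sup>+x. ennreal ((norm (S n x - Y x))\<^sup>2) \<partial>M) < ennreal e"
      by (auto simp: eventually_sequentially)
  qed
  then show ?thesis using Y by blast
qed

section \<open>Gaussian variables\<close>

lemma (in prob_space) char_distr:
  assumes "X \<in> borel_measurable M"
  shows "char (distr M borel X) s = (\<integral>\<omega>. iexp (s * X \<omega>) \<partial>M)"
  unfolding char_def by (rule integral_distr) (use assms in auto)

text \<open>The map \<open>iexp\<close> is 1-Lipschitz on the reals, so the characteristic functions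
  at \<open>s\<close> differ by at most \<bar>s\<bar> times the mean absolute difference, which
  tends to 0 along with the mean square.\<close>

lemma (in prob_space) L2_limit_char:
  assumes "L2_limit M f g"
  shows "(\<lambda>n. char (distr M borel (f n)) s) \<longlonglongrightarrow> char (distr M borel g) s"
proof -
  have sq: "square_integrable M (f n)" "square_integrable M g"
    and sqd: "square_integrable M (\<lambda>x. \<bar>f n x - g x\<bar>)" for n
    using assms square_integrable_diff[of M "f n" g]
    by (auto simp: L2_limit_def square_integrable_def)
  note [measurable] = sq[THEN square_integrable_measurable]
  have "L2_limit M (\<lambda>n x. \<bar>f n x - g x\<bar>) (\<lambda>_. 0)"
    using assms sqd square_integrable_const by (simp add: L2_limit_def)
  from L2_limit_integral[OF this] have lim: "(\<lambda>n. \<bar>s\<bar> * (\<integral>x. \<bar>f n x - g x\<bar> \<partial>M)) \<longlonglongrightarrow> 0"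
    by (simp add: tendsto_mult_right_zero)
  have "norm (char (distr M borel (f n)) s - char (distr M borel g) s)
      \<le> \<bar>s\<bar> * (\<integral>x. \<bar>f n x - g x\<bar> \<partial>M)" for n
  proof -
    have "char (distr M borel (f n)) s - char (distr M borel g) s
        = (\<integral>x. iexp (s * f n x) - iexp (s * g x) \<partial>M)"
      by (simp add: char_distr integrable_iexp)
    also have "norm \<dots> \<le> (\<integral>x. norm (iexp (s * f n x) - iexp (s * g x)) \<partial>M)"
      by (rule integral_norm_bound)
    also have "\<dots> \<le> (\<integral>x. \<bar>s\<bar> * \<bar>f n x - g x\<bar> \<partial>M)"
    proof (rule integral_mono)
      show "integrable M (\<lambda>x. norm (iexp (s * f n x) - iexp (s * g x)))"
        by (intro integrable_norm Bochner_Integration.integrable_diff integrable_iexp) auto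
      show "integrable M (\<lambda>x. \<bar>s\<bar> * \<bar>f n x - g x\<bar>)"
        using square_integrable_imp_integrable[OF sqd] by simp
      have "norm (iexp a - iexp b) \<le> \<bar>a - b\<bar>" for a b
      proof -
        have eq: "iexp a = iexp b * iexp (a - b)"
          using exp_add[of "\<i> * of_real b" "\<i> * of_real (a - b)"] by (simp flip: distrib_left)
        have "norm (iexp a - iexp b) = norm (iexp b * (iexp (a - b) - 1))"
          by (subst eq) (simp only: right_diff_distrib mult_1_right)
        also have "\<dots> = norm (iexp (a - b) - 1)"
          by (subst norm_mult) (simp only: norm_exp_i_times mult_1)
        also have "\<dots> \<le> \<bar>a - b\<bar>"
          using iexp_approx1[of "a - b" 0] by simp
        finally show ?thesis .
      qed
      moreover have "\<bar>s\<bar> * \<bar>f n x - g x\<bar> = \<bar>s * f n x - s * g x\<bar>" for x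
        by (metis abs_mult right_diff_distrib)
      ultimately show "norm (iexp (s * f n x) - iexp (s * g x)) \<le> \<bar>s\<bar> * \<bar>f n x - g x\<bar>" for x
        by metis
    qed
    finally show ?thesis by simp
  qed
  then show ?thesis
    by (rule LIM_zero_cancel[OF Lim_null_comparison[OF always_eventually[OF allI] lim]])
qed

text \<open>The parameters are the moments of \<open>X\<close> instead of those hidden in
  \<open>gaussian_var\<close>: one formula then serves point masses and normal densities, and it is
  continuous in quantities that pass to mean square limits.\<close>

lemma (in prob_space) char_gaussian_var:
  assumes "gaussian_var M X"
  shows "char (distr M borel X) s = iexp (s * expectation X) * exp (- (s\<^sup>2 * variance X) / 2)"
proof -
  have X[measurable]: "X \<in> borel_measurable M"
    using assms by (simp add: gaussian_var_def)
  consider \<mu> where "AE \<omega> in M. X \<omega> = \<mu>"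
    | \<mu> \<sigma> where "0 < \<sigma>" "distributed M lborel X (normal_density \<mu> \<sigma>)"
    using assms by (auto simp: gaussian_var_def)
  then show ?thesis
  proof cases
    case 1
    have E: "expectation X = \<mu>"
      using 1 by (subst integral_cong_AE[where g = "\<lambda>_. \<mu>"]) (auto simp: prob_space)
    have V: "variance X = 0"
      unfolding E using 1 by (subst integral_cong_AE[where g = "\<lambda>_. 0"]) auto
    have "char (distr M borel X) s = (\<integral>\<omega>. iexp (s * \<mu>) \<partial>M)"
      unfolding char_distr[OF X] using 1 by (intro integral_cong_AE) auto
    then show ?thesis unfolding V unfolding E by (simp add: prob_space)
  next
    case 2
    have E: "expectation X = \<mu>" and V: "variance X = \<sigma>\<^sup>2"
      using normal_distributed_expectation[OF 2] normal_distributed_variance[OF 2] by auto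
    let ?Y = "\<lambda>\<omega>. (X \<omega> - \<mu>) / \<sigma>"
    have "distributed M lborel ?Y std_normal_density"
      using 2(2) by (rule normal_standard_normal_convert[OF 2(1), THEN iffD1])
    then have "distr M borel ?Y = std_normal_distribution"
      by (auto simp: distributed_def cong: distr_cong)
    then have "char (distr M borel ?Y) (s * \<sigma>) = exp (- ((s * \<sigma>)\<^sup>2) / 2)"
      by (simp add: char_std_normal_distribution)
    then have *: "(\<integral>\<omega>. iexp (s * \<sigma> * ?Y \<omega>) \<partial>M) = exp (- ((s * \<sigma>)\<^sup>2) / 2)"
      by (simp add: char_distr)
    have "s * X \<omega> = s * \<mu> + s * \<sigma> * ?Y \<omega>" for \<omega>
      using 2(1) by (simp add: field_simps)
    then have "char (distr M borel X) s = (\<integral>\<omega>. iexp (s * \<mu>) * iexp (s * \<sigma> * ?Y \<omega>) \<partial>M)"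
      unfolding char_distr[OF X] by (simp only: of_real_add distrib_left exp_add)
    also have "\<dots> = iexp (s * \<mu>) * (\<integral>\<omega>. iexp (s * \<sigma> * ?Y \<omega>) \<partial>M)"
      by simp
    finally show ?thesis
      unfolding V unfolding E * by (simp add: power_mult_distrib)
  qed
qed

text \<open>Levy's uniqueness theorem identifies the law. For \<open>v = 0\<close> the
  characteristic function is that of a point mass; otherwise the standardised variable has the
  standard normal one. The two cases are the two alternatives of
  \<open>gaussian_var\<close>.\<close>

lemma (in prob_space) gaussian_varI_char:
  assumes X[measurable]: "X \<in> borel_measurable M" and v: "0 \<le> v"
    and char: "\<And>s. char (distr M borel X) s = iexp (s * \<mu>) * exp (- (s\<^sup>2 * v) / 2)"
  shows "gaussian_var M X"
proof (cases "v = 0")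
  case True
  have "distr M borel X = distr M borel (\<lambda>_. \<mu>)"
  proof (rule Levy_uniqueness)
    show "char (distr M borel X) = char (distr M borel (\<lambda>_. \<mu>))"
      by (rule ext) (simp only: char, simp add: True char_distr prob_space del: distr_const)
  qed (auto intro!: real_distribution_distr simp del: distr_const)
  moreover have "AE x in distr M borel (\<lambda>_. \<mu>). x = \<mu>"
    by (subst AE_distr_iff) auto
  ultimately have "AE x in distr M borel X. x = \<mu>" by (simp only:)
  then have "AE \<omega> in M. X \<omega> = \<mu>"
    by (subst (asm) AE_distr_iff) auto
  then show ?thesis by (auto simp: gaussian_var_def)
next
  case False
  define \<sigma> where "\<sigma> = sqrt v"
  have \<sigma>: "0 < \<sigma>" "\<sigma>\<^sup>2 = v" using v False by (auto simp: \<sigma>_def)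
  let ?Y = "\<lambda>\<omega>. (X \<omega> - \<mu>) / \<sigma>"
  have "distr M borel ?Y = std_normal_distribution"
  proof (rule Levy_uniqueness)
    show "char (distr M borel ?Y) = char std_normal_distribution"
    proof
      fix s
      have "s * ?Y \<omega> = - (s * \<mu> / \<sigma>) + s / \<sigma> * X \<omega>" for \<omega>
        using \<sigma>(1) by (simp add: field_simps)
      then have "char (distr M borel ?Y) s = (\<integral>\<omega>. iexp (- (s * \<mu> / \<sigma>)) * iexp (s / \<sigma> * X \<omega>) \<partial>M)"
        by (subst char_distr, simp, simp only: of_real_add distrib_left exp_add)
      also have "\<dots> = iexp (- (s * \<mu> / \<sigma>)) * char (distr M borel X) (s / \<sigma>)"
        by (simp add: char_distr)
      also have "\<dots> = iexp (- (s * \<mu> / \<sigma>)) * iexp (s / \<sigma> * \<mu>) * exp (- ((s / \<sigma>)\<^sup>2 * v) / 2)"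
        by (simp only: char mult.assoc)
      also have "\<dots> = exp (- (s\<^sup>2) / 2)"
        unfolding \<sigma>(2)[symmetric] exp_add[symmetric]
        using \<sigma>(1) by (simp add: power_divide)
      finally show "char (distr M borel ?Y) s = char std_normal_distribution s"
        by (simp add: char_std_normal_distribution)
    qed
  qed (auto intro!: real_distribution_distr real_dist_normal_dist)
  then have "distributed M lborel ?Y std_normal_density"
    by (auto simp: distributed_def cong: distr_cong)
  then have "distributed M lborel X (normal_density \<mu> \<sigma>)"
    by (rule normal_standard_normal_convert[OF \<sigma>(1), THEN iffD2])
  then show ?thesis using \<sigma> by (auto simp: gaussian_var_def)
qed

text \<open>Means and variances converge, hence so do the Gaussian characteristic functions that
  they determine. Their limit is the characteristic function of \<open>g\<close> and has the same
  shape, possibly with variance 0.\<close>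

lemma (in prob_space) gaussian_var_L2_limit:
  assumes lim: "L2_limit M f g" and gauss: "\<And>n. gaussian_var M (f n)"
  shows "gaussian_var M g"
proof -
  have sq: "square_integrable M (f n)" "square_integrable M g" for n
    using lim by (auto simp: L2_limit_def)
  have var: "variance h = (\<integral>x. h x * h x \<partial>M) - (expectation h)\<^sup>2" if "square_integrable M h" for h
    using that square_integrable_imp_integrable[OF that]
    by (subst variance_eq) (auto simp: square_integrable_def power2_eq_square)
  note E = L2_limit_integral[OF lim]
  have V: "(\<lambda>n. variance (f n)) \<longlonglongrightarrow> variance g"
    unfolding var[OF sq(1)] var[OF sq(2)]
    by (intro tendsto_intros E L2_limit_integral_mult lim)
  show ?thesis
  proof (rule gaussian_varI_char)
    show "char (distr M borel g) s = iexp (s * expectation g) * exp (- (s\<^sup>2 * variance g) / 2)" for s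
    proof (rule LIMSEQ_unique)
      show "(\<lambda>n. char (distr M borel (f n)) s) \<longlonglongrightarrow> char (distr M borel g) s"
        by (rule L2_limit_char[OF lim])
      show "(\<lambda>n. char (distr M borel (f n)) s)
          \<longlonglongrightarrow> iexp (s * expectation g) * exp (- (s\<^sup>2 * variance g) / 2)"
        unfolding char_gaussian_var[OF gauss]
        by (intro tendsto_intros E V) auto
    qed
  qed (use sq in \<open>auto simp: square_integrable_def\<close>)
qed

text \<open>Characteristic functions of independent variables multiply, so means and variances add
  up in the exponents.\<close>

lemma (in prob_space) gaussian_var_sum_indep:
  assumes indep: "indep_vars (\<lambda>_. borel) X A" and gauss: "\<And>k. k \<in> A \<Longrightarrow> gaussian_var M (X k)"
  shows "gaussian_var M (\<lambda>\<omega>. \<Sum>k\<in>A. X k \<omega>)"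
proof (rule gaussian_varI_char)
  show "(\<lambda>\<omega>. \<Sum>k\<in>A. X k \<omega>) \<in> borel_measurable M"
    using gauss by (intro borel_measurable_sum) (auto simp: gaussian_var_def)
  show "0 \<le> (\<Sum>k\<in>A. variance (X k))"
    by (intro sum_nonneg) simp
  show "char (distr M borel (\<lambda>\<omega>. \<Sum>k\<in>A. X k \<omega>)) s =
      iexp (s * (\<Sum>k\<in>A. expectation (X k))) * exp (- (s\<^sup>2 * (\<Sum>k\<in>A. variance (X k))) / 2)" for s
  \<comment> \<open>Over an infinite set all three sums are 0 by convention, and the claim is about
    the constant 0.\<close>
  proof (cases "finite A")
    case True
    have "char (distr M borel (\<lambda>\<omega>. \<Sum>k\<in>A. X k \<omega>)) s =
        (\<Prod>k\<in>A. iexp (s * expectation (X k)) * exp (- (s\<^sup>2 * variance (X k)) / 2))"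
      unfolding char_distr_sum[OF indep]
      by (intro prod.cong refl char_gaussian_var gauss)
    also have "\<dots> = iexp (s * (\<Sum>k\<in>A. expectation (X k))) * exp (- (s\<^sup>2 * (\<Sum>k\<in>A. variance (X k))) / 2)"
      using True by (simp only: sum_distrib_left sum_divide_distrib of_real_sum
          sum_negf[symmetric]
          exp_sum prod.distrib of_real_prod)
    finally show ?thesis .
  qed (simp add: char_distr prob_space del: distr_const)
qed

section \<open>Trigonometric sums over a grid\<close>

text \<open>The index matches that of the processes \<open>V n 1\<close> and \<open>V n 2\<close>,
  so that a partial sum of the series becomes a single sum over pairs (n, j).\<close>

definition trig :: "nat \<Rightarrow> real \<Rightarrow> real" where
  "trig j x = (if j = 1 then cos x else sin x)"

lemma abs_trig_le_1: "\<bar>trig j x\<bar> \<le> 1"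
  by (simp add: trig_def)

lemma trig_mult_sum: "(\<Sum>j\<in>{1, 2}. trig j x * trig j y) = cos (x - y)"
  by (simp add: trig_def cos_diff)

definition grid :: "nat \<Rightarrow> nat \<Rightarrow> real" where
  "grid N k = 2 * pi * real k / real N"

lemma grid_bounds: "k < N \<Longrightarrow> grid N k \<in> {0..2 * pi}"
  by (simp add: grid_def field_simps)

text \<open>Both sums are parts of the geometric sum of
  \<open>cis (2 * pi * real d / real N)\<close>, an N-th root of unity that differs from 1 because N
  does not divide \<open>d\<close>.\<close>

lemma grid_sums_nat:
  assumes "0 < d" "d < N"
  shows "(\<Sum>k<N. cos (real d * grid N k)) = 0" "(\<Sum>k<N. sin (real d * grid N k)) = 0"
proof -
  define z where "z = cis (2 * pi * real d / real N)"
  have "z \<noteq> 1"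
  proof
    assume "z = 1"
    then have "cos (2 * pi * real d / real N) = 1"
      by (simp add: z_def complex_eq_iff)
    then obtain m :: int where "2 * pi * real d / real N = of_int m * 2 * pi"
      by (auto simp: cos_one_2pi_int)
    then have "real d = of_int m * real N" using assms by (simp add: field_simps)
    then have "int d = m * int N"
      by (metis of_int_eq_iff of_int_mult of_int_of_nat_eq)
    then have "int N dvd int d" by simp
    then show False using assms by (auto dest: dvd_imp_le)
  qed
  moreover have "z ^ N = 1"
  proof -
    have "z ^ N = cis (2 * pi * real d)"
      using assms by (simp add: z_def Complex.DeMoivre)
    then show ?thesis by (simp add: cis_multiple_2pi)
  qed
  ultimately have "(\<Sum>k<N. z ^ k) = 0"
    by (simp add: geometric_sum)
  moreover have "z ^ k = cis (real d * grid N k)" for k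
    by (simp add: z_def Complex.DeMoivre grid_def mult_ac)
  ultimately have "(\<Sum>k<N. cis (real d * grid N k)) = 0" by simp
  from arg_cong[OF this, of Re] arg_cong[OF this, of Im]
  show "(\<Sum>k<N. cos (real d * grid N k)) = 0" "(\<Sum>k<N. sin (real d * grid N k)) = 0"
    by simp_all
qed

lemma grid_sums_diff:
  assumes "n < N" "m < N"
  shows "(\<Sum>k<N. cos ((real n - real m) * grid N k)) = (if n = m then real N else 0)"
    "(\<Sum>k<N. sin ((real n - real m) * grid N k)) = 0"
proof -
  consider "n = m" | "m < n" | "n < m" by linarith
  then have "(\<Sum>k<N. cos ((real n - real m) * grid N k)) = (if n = m then real N else 0) \<and>
    (\<Sum>k<N. sin ((real n - real m) * grid N k)) = 0"
  proof cases
    case 2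
    then show ?thesis using grid_sums_nat[of "n - m" N] assms by (simp add: of_nat_diff)
  next
    case 3
    have "cos ((real n - real m) * x) = cos (real (m - n) * x)"
      "sin ((real n - real m) * x) = - sin (real (m - n) * x)" for x
    proof -
      have "(real n - real m) * x = - (real (m - n) * x)"
        using 3 by (simp add: of_nat_diff algebra_simps)
      then show "cos ((real n - real m) * x) = cos (real (m - n) * x)"
        "sin ((real n - real m) * x) = - sin (real (m - n) * x)"
        by (simp_all only: cos_minus sin_minus)
    qed
    then show ?thesis using 3 grid_sums_nat[of "m - n" N] assms by (simp add: sum_negf)
  qed simp
  then show "(\<Sum>k<N. cos ((real n - real m) * grid N k)) = (if n = m then real N else 0)"
    "(\<Sum>k<N. sin ((real n - real m) * grid N k)) = 0" by auto
qed

lemma grid_sums_add: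
  assumes "n + m < N"
  shows "(\<Sum>k<N. cos ((real n + real m) * grid N k)) = (if n = 0 \<and> m = 0 then real N else 0)"
    "(\<Sum>k<N. sin ((real n + real m) * grid N k)) = 0"
  using grid_sums_nat[of "n + m" N] assms by (cases "n + m = 0"; simp)+

text \<open>Products are turned into sums, whose frequencies n - m and n + m stay strictly between
  -N and N; only frequency 0 survives on the grid. The factor 1 or 2 is the inverse of the grid mean
  of the squared function, which is 1 for the constant of order 0 and 1/2 otherwise. The pair of
  order 0 and sine is excluded since that function vanishes.\<close>

lemma trig_orthogonal:
  assumes nm: "n + m < N" and j: "j \<in> {1, 2}" and l: "l \<in> {1, 2}" and "n = 0 \<longrightarrow> j = 1"
  shows "(if n = 0 then 1 else 2) / real N *
      (\<Sum>k<N. trig j (real n * grid N k) * trig l (real m * grid N k)) =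
    (if n = m \<and> j = l then 1 else 0)"
proof -
  have N: "0 < N" "n < N" "m < N" using nm by auto
  let ?c = "\<lambda>r. \<Sum>k<N. cos (r * grid N k)" and ?s = "\<lambda>r. \<Sum>k<N. sin (r * grid N k)"
  have cc: "(\<Sum>k<N. cos (real n * grid N k) * cos (real m * grid N k))
      = (?c (real n - real m) + ?c (real n + real m)) / 2"
    by (simp add: left_diff_distrib distrib_right cos_diff cos_add sin_diff sin_add
        sum.distrib sum_subtractf)
  have ss: "(\<Sum>k<N. sin (real n * grid N k) * sin (real m * grid N k))
      = (?c (real n - real m) - ?c (real n + real m)) / 2"
    by (simp add: left_diff_distrib distrib_right cos_diff cos_add sin_diff sin_add
        sum.distrib sum_subtractf)
  have sc: "(\<Sum>k<N. sin (real n * grid N k) * cos (real m * grid N k))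
      = (?s (real n + real m) + ?s (real n - real m)) / 2"
    by (simp add: left_diff_distrib distrib_right cos_diff cos_add sin_diff sin_add
        sum.distrib sum_subtractf)
  have cs: "(\<Sum>k<N. cos (real n * grid N k) * sin (real m * grid N k))
      = (?s (real n + real m) - ?s (real n - real m)) / 2"
    by (simp add: left_diff_distrib distrib_right cos_diff cos_add sin_diff sin_add
        sum.distrib sum_subtractf)
  have tr: "trig 1 = cos" "trig 2 = sin"
    by (auto simp: trig_def fun_eq_iff)
  note sums = grid_sums_diff[OF N(2,3)] grid_sums_add[OF nm]
  consider "j = 1" "l = 1" | "j = 1" "l = 2" | "j = 2" "l = 1" | "j = 2" "l = 2"
    using j l by auto
  then show ?thesis
  proof cases
    case 1
    then show ?thesis using N unfolding 1 tr cc sums by auto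
  next
    case 2
    then show ?thesis using N unfolding 2 tr cs sums by auto
  next
    case 3
    then show ?thesis using N unfolding 3 tr sc sums by auto
  next
    case 4
    then show ?thesis using N assms(4) unfolding 4 tr ss sums by auto
  qed
qed

section \<open>Vector-valued processes\<close>

lemma borel_measurable_vec_nth [measurable (raw)]:
  fixes f :: "'a \<Rightarrow> real ^ 'm"
  shows "f \<in> borel_measurable M \<Longrightarrow> (\<lambda>x. f x $ i) \<in> borel_measurable M"
  by (rule measurable_compose[OF _ borel_measurable_nth])

lemma square_integrable_vec_nth:
  fixes X :: "'a \<Rightarrow> real ^ 'm"
  assumes [measurable]: "X \<in> borel_measurable M" and "integrable M (\<lambda>\<omega>. (norm (X \<omega>))\<^sup>2)"
  shows "square_integrable M (\<lambda>\<omega>. X \<omega> $ i)"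
  by (rule square_integrable_bound[where g = "\<lambda>\<omega>. norm (X \<omega>)"])
    (use assms in \<open>auto simp: square_integrable_def component_le_norm_cart\<close>)

text \<open>The norm dominates every component. The comparison is made under the nonnegative
  integral because square integrability of the components of \<open>Y\<close> is part of the
  conclusion.\<close>

lemma mean_square_sums_L2_limit:
  fixes X :: "nat \<Rightarrow> 'a \<Rightarrow> real ^ 'm"
  assumes lim: "mean_square_sums M X Y"
    and X[measurable]: "\<And>n. X n \<in> borel_measurable M"
    and sq: "\<And>n i. square_integrable M (\<lambda>\<omega>. X n \<omega> $ i)"
  shows "L2_limit M (\<lambda>N \<omega>. (\<Sum>n<N. X n \<omega>) $ i) (\<lambda>\<omega>. Y \<omega> $ i)"
proof (rule L2_limit_nn_integral)
  have Y[measurable]: "Y \<in> borel_measurable M"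
    and lim0: "(\<lambda>N. \<integral>\<^sup>+\<omega>. ennreal ((norm ((\<Sum>n<N. X n \<omega>) - Y \<omega>))\<^sup>2) \<partial>M) \<longlonglongrightarrow> 0"
    using lim by (auto simp: mean_square_sums_def)
  show "square_integrable M (\<lambda>\<omega>. (\<Sum>n<N. X n \<omega>) $ i)" for N
    using sq by (auto simp: sum_component intro: square_integrable_sum)
  show "(\<lambda>\<omega>. Y \<omega> $ i) \<in> borel_measurable M" by measurable
  have le: "(\<integral>\<^sup>+\<omega>. ennreal (((\<Sum>n<N. X n \<omega>) $ i - Y \<omega> $ i)\<^sup>2) \<partial>M)
      \<le> (\<integral>\<^sup>+\<omega>. ennreal ((norm ((\<Sum>n<N. X n \<omega>) - Y \<omega>))\<^sup>2) \<partial>M)" for N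
  proof (rule nn_integral_mono, rule ennreal_leI)
    fix \<omega>
    have "\<bar>((\<Sum>n<N. X n \<omega>) - Y \<omega>) $ i\<bar> \<le> \<bar>norm ((\<Sum>n<N. X n \<omega>) - Y \<omega>)\<bar>"
      by (simp only: abs_norm_cancel component_le_norm_cart)
    then show "((\<Sum>n<N. X n \<omega>) $ i - Y \<omega> $ i)\<^sup>2 \<le> (norm ((\<Sum>n<N. X n \<omega>) - Y \<omega>))\<^sup>2"
      unfolding abs_le_square_iff by simp
  qed
  show "(\<lambda>N. \<integral>\<^sup>+\<omega>. ennreal (((\<Sum>n<N. X n \<omega>) $ i - Y \<omega> $ i)\<^sup>2) \<partial>M) \<longlonglongrightarrow> 0"
    by (rule tendsto_sandwich[OF _ _ tendsto_const lim0]) (use le in auto)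
qed

lemma L2_limit_inner:
  fixes f :: "nat \<Rightarrow> 'a \<Rightarrow> real ^ 'm"
  assumes "\<And>i. L2_limit M (\<lambda>n \<omega>. f n \<omega> $ i) (\<lambda>\<omega>. g \<omega> $ i)"
  shows "L2_limit M (\<lambda>n \<omega>. a \<bullet> f n \<omega>) (\<lambda>\<omega>. a \<bullet> g \<omega>)"
  unfolding inner_vec_def inner_real_def by (intro L2_limit_sum L2_limit_cmult assms)

lemma L2_limit_unique:
  assumes "L2_limit M f g" "L2_limit M f h"
  shows "AE x in M. g x = h x"
proof -
  \<comment> \<open>This sequence is constantly 0, so its mean square distance to the limit, the
    difference of \<open>g\<close> and \<open>h\<close>, is independent of \<open>n\<close> and
    therefore equal to 0.\<close>
  have "L2_limit M (\<lambda>n x. f n x + - 1 * f n x) (\<lambda>x. g x + - 1 * h x)"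
    by (intro L2_limit_add L2_limit_cmult assms)
  then have "(\<lambda>n. \<integral>x. (f n x + - 1 * f n x - (g x + - 1 * h x))\<^sup>2 \<partial>M) \<longlonglongrightarrow> 0"
    and sq: "square_integrable M (\<lambda>x. g x + - 1 * h x)"
    by (auto simp only: L2_limit_def)
  then have "(\<lambda>n::nat. \<integral>x. (h x - g x)\<^sup>2 \<partial>M) \<longlonglongrightarrow> 0"
    by simp
  then have "(\<integral>x. (h x - g x)\<^sup>2 \<partial>M) = 0"
    by (simp add: LIMSEQ_const_iff)
  moreover have "integrable M (\<lambda>x. (h x - g x)\<^sup>2)"
    using sq by (simp add: square_integrable_def power2_commute)
  ultimately have "AE x in M. (h x - g x)\<^sup>2 = 0"
    by (subst (asm) integral_nonneg_eq_0_iff_AE) auto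
  then show ?thesis by eventually_elim simp
qed

text \<open>In \<open>gaussian_field\<close> every index occurs once in a combination. Where
  \<open>h\<close> repeats an index, the coefficients of its preimages are added up. Repetitions do
  arise: points of the sphere that differ only in longitude share one value of a coefficient
  process.\<close>

lemma gaussian_field_reindex:
  fixes X :: "'i \<Rightarrow> 'a \<Rightarrow> real ^ 'm"
  assumes X: "gaussian_field M I X" and J: "finite J" "h ` J \<subseteq> I"
  shows "gaussian_var M (\<lambda>\<omega>. \<Sum>x\<in>J. b x \<bullet> X (h x) \<omega>)"
proof -
  have "(\<Sum>x\<in>J. b x \<bullet> X (h x) \<omega>)
      = (\<Sum>i\<in>h ` J. (\<Sum>x\<in>{x \<in> J. h x = i}. b x) \<bullet> X i \<omega>)" for \<omega>
    using J(1) by (subst sum.image_gen[of J _ h]) (auto simp: inner_sum_left intro!: sum.cong)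
  then show ?thesis
    using X J by (simp add: gaussian_field_def)
qed

lemma (in prob_space) gaussian_var_zero: "gaussian_var M (\<lambda>_. 0)"
  by (auto simp: gaussian_var_def)

section \<open>The longitude series\<close>

locale longitude_model = prob_space M for M :: "'a measure" +
  fixes T :: "real set"
    and V :: "nat \<Rightarrow> nat \<Rightarrow> real \<times> real \<Rightarrow> 'a \<Rightarrow> real ^ 'm"
    and B :: "nat \<Rightarrow> real \<Rightarrow> real \<Rightarrow> real \<Rightarrow> real ^ 'm ^ 'm"
  assumes T: "T = UNIV \<or> T = \<int>"
    and second_order: "\<And>n j. j \<in> {1, 2} \<Longrightarrow> second_order_field M ({0..pi} \<times> T) (V n j)"
    and mean_zero: "\<And>n j \<phi> t. j \<in> {1, 2} \<Longrightarrow> \<phi> \<in> {0..pi} \<Longrightarrow> t \<in> T \<Longrightarrow>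
      integral\<^sup>L M (V n j (\<phi>, t)) = 0"
    and covariance: "\<And>n j \<phi>\<^sub>1 \<phi>\<^sub>2 t\<^sub>1 t\<^sub>2. j \<in> {1, 2} \<Longrightarrow> \<phi>\<^sub>1 \<in> {0..pi} \<Longrightarrow> \<phi>\<^sub>2 \<in> {0..pi} \<Longrightarrow>
      t\<^sub>1 \<in> T \<Longrightarrow> t\<^sub>2 \<in> T \<Longrightarrow>
      cov_matrix M (V n j (\<phi>\<^sub>1, t\<^sub>1)) (V n j (\<phi>\<^sub>2, t\<^sub>2)) = B n \<phi>\<^sub>1 \<phi>\<^sub>2 (t\<^sub>1 - t\<^sub>2)"
    and independent: "independent_processes M ({0..pi} \<times> T) (\<lambda>(n, j). V n j) (UNIV \<times> {1, 2})"
    and summable: "\<And>\<phi>\<^sub>1 \<phi>\<^sub>2 t. \<phi>\<^sub>1 \<in> {0..pi} \<Longrightarrow> \<phi>\<^sub>2 \<in> {0..pi} \<Longrightarrow> t \<in> T \<Longrightarrow>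
      summable (\<lambda>n. B n \<phi>\<^sub>1 \<phi>\<^sub>2 t)"
begin

abbreviation I where "I \<equiv> {0..pi} \<times> T"

definition summand where
  "summand \<phi> \<theta> t n \<omega> = cos (real n * \<theta>) *\<^sub>R V n 1 (\<phi>, t) \<omega> + sin (real n * \<theta>) *\<^sub>R V n 2 (\<phi>, t) \<omega>"

lemma zero_in_T: "0 \<in> T"
  using T by auto

lemma V_measurable: "j \<in> {1, 2} \<Longrightarrow> p \<in> I \<Longrightarrow> V n j p \<in> borel_measurable M"
  using second_order[of j n] by (auto simp: second_order_field_def)

lemma V_square_integrable:
  "j \<in> {1, 2} \<Longrightarrow> p \<in> I \<Longrightarrow> square_integrable M (\<lambda>\<omega>. V n j p \<omega> $ i)"
  using second_order[of j n] by (intro square_integrable_vec_nth) (auto simp: second_order_field_def)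

lemma V_integrable: "j \<in> {1, 2} \<Longrightarrow> p \<in> I \<Longrightarrow> integrable M (V n j p)"
proof -
  assume jp: "j \<in> {1, 2}" "p \<in> I"
  have "square_integrable M (\<lambda>\<omega>. norm (V n j p \<omega>))"
    using second_order[OF jp(1), of n] jp(2) V_measurable[OF jp, of n]
    by (auto simp: second_order_field_def square_integrable_def)
  then show ?thesis
    by (rule integrable_norm_cancel[OF square_integrable_imp_integrable V_measurable[OF jp]])
qed

lemma V_mean_component:
  assumes "j \<in> {1, 2}" "p \<in> I"
  shows "(\<integral>\<omega>. V n j p \<omega> $ i \<partial>M) = 0"
proof -
  have "(\<integral>\<omega>. V n j p \<omega> \<bullet> axis i 1 \<partial>M) = integral\<^sup>L M (V n j p) \<bullet> axis i 1"
    by (intro integral_inner_left V_integrable assms)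
  then show ?thesis
    using assms mean_zero[of j "fst p" "snd p" n] by (simp add: inner_axis mem_Times_iff)
qed

text \<open>Independence is assumed for whole paths, as elements of a product space; it passes to
  measurable functionals of them. Both uses involve finitely many coordinates: evaluation at one
  point, and a linear combination of several values.\<close>

lemma indep_functionals:
  assumes "\<And>u. u \<in> K \<Longrightarrow> Y u \<in> borel_measurable (PiM I (\<lambda>_. borel))" "K \<subseteq> UNIV \<times> {1, 2}"
  shows "indep_vars (\<lambda>_. borel) (\<lambda>u \<omega>. Y u (\<lambda>p\<in>I. V (fst u) (snd u) p \<omega>)) K"
proof -
  have "indep_vars (\<lambda>_. PiM I (\<lambda>_. borel)) (\<lambda>u \<omega>. \<lambda>p\<in>I. V (fst u) (snd u) p \<omega>) K"
    using indep_vars_subset[OF independent[unfolded independent_processes_def] assms(2)]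
    by (simp add: case_prod_unfold)
  then show ?thesis
    by (rule indep_vars_compose2) (use assms in auto)
qed

lemma V_product_integral:
  assumes u: "u \<in> UNIV \<times> {1, 2}" and v: "v \<in> UNIV \<times> {1, 2}"
    and \<phi>: "\<phi>\<^sub>1 \<in> {0..pi}" "\<phi>\<^sub>2 \<in> {0..pi}" and t: "t\<^sub>1 \<in> T" "t\<^sub>2 \<in> T"
  shows "(\<integral>\<omega>. V (fst u) (snd u) (\<phi>\<^sub>1, t\<^sub>1) \<omega> $ i * V (fst v) (snd v) (\<phi>\<^sub>2, t\<^sub>2) \<omega> $ k \<partial>M)
    = (if u = v then B (fst u) \<phi>\<^sub>1 \<phi>\<^sub>2 (t\<^sub>1 - t\<^sub>2) $ i $ k else 0)"
proof (cases "u = v")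
  case True
  have j: "snd v \<in> {1, 2}" using v by auto
  have "B (fst v) \<phi>\<^sub>1 \<phi>\<^sub>2 (t\<^sub>1 - t\<^sub>2) $ i $ k
      = cov_matrix M (V (fst v) (snd v) (\<phi>\<^sub>1, t\<^sub>1)) (V (fst v) (snd v) (\<phi>\<^sub>2, t\<^sub>2)) $ i $ k"
    using covariance[OF j \<phi> t] by simp
  also have "\<dots> = (\<integral>\<omega>. V (fst v) (snd v) (\<phi>\<^sub>1, t\<^sub>1) \<omega> $ i * V (fst v) (snd v) (\<phi>\<^sub>2, t\<^sub>2) \<omega> $ k \<partial>M)"
    using j \<phi> t by (simp add: cov_matrix_def mean_zero)
  finally show ?thesis using True by simp
next
  case False
  define p q where "p = (\<phi>\<^sub>1, t\<^sub>1)" and "q = (\<phi>\<^sub>2, t\<^sub>2)"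
  have p: "p \<in> I" and q: "q \<in> I" using \<phi> t by (auto simp: p_def q_def)
  have ju: "snd u \<in> {1, 2}" and jv: "snd v \<in> {1, 2}" using u v by auto
  \<comment> \<open>One family of functionals must serve both processes, so the point and the
    component to be read are selected by the index. Independence then factorises the mean of the
    product, and each factor has mean 0.\<close>
  define Y :: "nat \<times> nat \<Rightarrow> (real \<times> real \<Rightarrow> real ^ 'm) \<Rightarrow> real"
    where "Y w x = (if w = u then x p $ i else x q $ k)" for w x
  have "Y w \<in> borel_measurable (PiM I (\<lambda>_. borel))" for w
  proof -
    have "(\<lambda>x. x r $ l) \<in> borel_measurable (PiM I (\<lambda>_. borel :: (real ^ 'm) measure))"
      if "r \<in> I" for r l
      using measurable_component_singleton[OF that, of "\<lambda>_. borel :: (real ^ 'm) measure"]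
      by measurable
    from this[OF p] this[OF q] show ?thesis by (cases "w = u") (auto simp: Y_def[abs_def])
  qed
  then have ind: "indep_vars (\<lambda>_. borel) (\<lambda>w \<omega>. Y w (\<lambda>p\<in>I. V (fst w) (snd w) p \<omega>)) {u, v}"
    using u v by (intro indep_functionals) auto
  have "(\<integral>\<omega>. (\<Prod>w\<in>{u, v}. Y w (\<lambda>p\<in>I. V (fst w) (snd w) p \<omega>)) \<partial>M)
      = (\<Prod>w\<in>{u, v}. \<integral>\<omega>. Y w (\<lambda>p\<in>I. V (fst w) (snd w) p \<omega>) \<partial>M)"
  proof (rule indep_vars_lebesgue_integral[OF _ ind])
    show "integrable M (\<lambda>\<omega>. Y w (\<lambda>p\<in>I. V (fst w) (snd w) p \<omega>))" if "w \<in> {u, v}" for w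
      using that False p q ju jv
      by (auto simp: Y_def intro!: square_integrable_imp_integrable V_square_integrable)
  qed simp
  then show ?thesis
    using False p q ju by (simp add: Y_def V_mean_component p_def[symmetric] q_def[symmetric])
qed

section \<open>Moments of the partial sums and existence of the series\<close>

lemma summand_component:
  "summand \<phi> \<theta> t n \<omega> $ i = (\<Sum>j\<in>{1, 2}. trig j (real n * \<theta>) * V n j (\<phi>, t) \<omega> $ i)"
  by (simp add: summand_def trig_def)

lemma summand_measurable:
  assumes "\<phi> \<in> {0..pi}" "t \<in> T"
  shows "summand \<phi> \<theta> t n \<in> borel_measurable M"
proof -
  have [measurable]: "V n 1 (\<phi>, t) \<in> borel_measurable M" "V n 2 (\<phi>, t) \<in> borel_measurable M"
    using assms by (auto intro: V_measurable)
  show ?thesis unfolding summand_def[abs_def] by measurable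
qed

lemma summand_square_integrable:
  assumes "\<phi> \<in> {0..pi}" "t \<in> T"
  shows "square_integrable M (\<lambda>\<omega>. summand \<phi> \<theta> t n \<omega> $ i)"
  unfolding summand_component using assms
  by (intro square_integrable_sum square_integrable_cmult V_square_integrable) auto

lemma summand_mean_component:
  assumes "\<phi> \<in> {0..pi}" "t \<in> T"
  shows "(\<integral>\<omega>. summand \<phi> \<theta> t n \<omega> $ i \<partial>M) = 0"
  unfolding summand_component using assms
  by (subst Bochner_Integration.integral_sum)
    (auto intro!: integrable_mult_right square_integrable_imp_integrable V_square_integrable
      simp: V_mean_component)

text \<open>An arbitrary finite set of orders is allowed since several kinds are needed: initial
  segments for the covariance of \<open>Z\<close>, intervals for increments and remainders,
  singletons for the sign of the diagonal entries of \<open>B\<close>.\<close>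

lemma summand_product_integral:
  assumes A: "finite A" and \<phi>: "\<phi>\<^sub>1 \<in> {0..pi}" "\<phi>\<^sub>2 \<in> {0..pi}" and t: "t\<^sub>1 \<in> T" "t\<^sub>2 \<in> T"
  shows "(\<integral>\<omega>. (\<Sum>n\<in>A. summand \<phi>\<^sub>1 \<theta>\<^sub>1 t\<^sub>1 n \<omega> $ i) * (\<Sum>n\<in>A. summand \<phi>\<^sub>2 \<theta>\<^sub>2 t\<^sub>2 n \<omega> $ k) \<partial>M)
    = (\<Sum>n\<in>A. cos (real n * (\<theta>\<^sub>1 - \<theta>\<^sub>2)) * B n \<phi>\<^sub>1 \<phi>\<^sub>2 (t\<^sub>1 - t\<^sub>2) $ i $ k)"
proof -
  let ?K = "A \<times> {1, 2 :: nat}"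
  let ?e = "\<lambda>\<theta> u. trig (snd u) (real (fst u) * \<theta>)"
  let ?V = "\<lambda>p l u \<omega>. V (fst u) (snd u) p \<omega> $ l"
  have K: "u \<in> UNIV \<times> {1, 2}" if "u \<in> ?K" for u using that by auto
  have summand: "(\<Sum>n\<in>A. summand \<phi> \<theta> t n \<omega> $ l) = (\<Sum>u\<in>?K. ?e \<theta> u * ?V (\<phi>, t) l u \<omega>)" for \<phi> \<theta> t l \<omega>
    unfolding summand_component using A by (subst sum.cartesian_product) (simp add: case_prod_unfold)
  have int: "integrable M (\<lambda>\<omega>. ?V (\<phi>\<^sub>1, t\<^sub>1) i u \<omega> * ?V (\<phi>\<^sub>2, t\<^sub>2) k v \<omega>)"
    if "u \<in> ?K" "v \<in> ?K" for u v
    using that \<phi> t by (intro square_integrable_mult V_square_integrable) auto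
  have "(\<integral>\<omega>. (\<Sum>n\<in>A. summand \<phi>\<^sub>1 \<theta>\<^sub>1 t\<^sub>1 n \<omega> $ i) * (\<Sum>n\<in>A. summand \<phi>\<^sub>2 \<theta>\<^sub>2 t\<^sub>2 n \<omega> $ k) \<partial>M)
      = (\<integral>\<omega>. (\<Sum>u\<in>?K. \<Sum>v\<in>?K. (?e \<theta>\<^sub>1 u * ?e \<theta>\<^sub>2 v) * (?V (\<phi>\<^sub>1, t\<^sub>1) i u \<omega> * ?V (\<phi>\<^sub>2, t\<^sub>2) k v \<omega>)) \<partial>M)"
    unfolding summand sum_product by (simp only: mult_ac)
  also have "\<dots> = (\<Sum>u\<in>?K. \<Sum>v\<in>?K. (?e \<theta>\<^sub>1 u * ?e \<theta>\<^sub>2 v) *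
      (\<integral>\<omega>. ?V (\<phi>\<^sub>1, t\<^sub>1) i u \<omega> * ?V (\<phi>\<^sub>2, t\<^sub>2) k v \<omega> \<partial>M))"
    using int by (simp add: Bochner_Integration.integral_sum Bochner_Integration.integrable_sum)
  also have "\<dots> = (\<Sum>u\<in>?K. \<Sum>v\<in>?K. if u = v then
      (?e \<theta>\<^sub>1 u * ?e \<theta>\<^sub>2 v) * B (fst u) \<phi>\<^sub>1 \<phi>\<^sub>2 (t\<^sub>1 - t\<^sub>2) $ i $ k else 0)"
    by (intro sum.cong refl, subst V_product_integral[OF K K \<phi> t]) auto
  also have "\<dots> = (\<Sum>u\<in>?K. (?e \<theta>\<^sub>1 u * ?e \<theta>\<^sub>2 u) * B (fst u) \<phi>\<^sub>1 \<phi>\<^sub>2 (t\<^sub>1 - t\<^sub>2) $ i $ k)"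
    using A by (intro sum.cong refl, subst sum.delta') auto
  also have "\<dots> = (\<Sum>n\<in>A. \<Sum>j\<in>{1, 2}. (trig j (real n * \<theta>\<^sub>1) * trig j (real n * \<theta>\<^sub>2)) *
      B n \<phi>\<^sub>1 \<phi>\<^sub>2 (t\<^sub>1 - t\<^sub>2) $ i $ k)"
    by (subst sum.cartesian_product) (simp add: case_prod_unfold)
  also have "\<dots> = (\<Sum>n\<in>A. cos (real n * (\<theta>\<^sub>1 - \<theta>\<^sub>2)) * B n \<phi>\<^sub>1 \<phi>\<^sub>2 (t\<^sub>1 - t\<^sub>2) $ i $ k)"
    by (simp only: sum_distrib_right[symmetric] trig_mult_sum right_diff_distrib)
  finally show ?thesis .
qed

text \<open>At equal longitudes every cosine is \<open>cos 0 = 1\<close>, so \<theta> disappears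
  from the right-hand side. All bounds that are uniform in the longitude come from here.\<close>

lemma summand_square_integral:
  assumes "finite A" "\<phi> \<in> {0..pi}" "t \<in> T"
  shows "(\<integral>\<omega>. (\<Sum>n\<in>A. summand \<phi> \<theta> t n \<omega> $ i)\<^sup>2 \<partial>M) = (\<Sum>n\<in>A. B n \<phi> \<phi> 0 $ i $ i)"
  using summand_product_integral[OF assms(1,2,2,3,3), of \<theta> i \<theta> i] by (simp add: power2_eq_square)

text \<open>The entry is the second moment of a single term of the series at longitude 0 and time 0,
  both of which are available in every temporal domain considered.\<close>

lemma B_diagonal_nonneg:
  assumes "\<phi> \<in> {0..pi}"
  shows "0 \<le> B n \<phi> \<phi> 0 $ i $ i"
proof -
  have "0 \<le> (\<integral>\<omega>. (\<Sum>n\<in>{n}. summand \<phi> 0 0 n \<omega> $ i)\<^sup>2 \<partial>M)" by simp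
  also have "\<dots> = B n \<phi> \<phi> 0 $ i $ i"
    using summand_square_integral[of "{n}" \<phi> 0 0 i] assms zero_in_T by simp
  finally show ?thesis .
qed

lemma summable_B_component:
  assumes "\<phi>\<^sub>1 \<in> {0..pi}" "\<phi>\<^sub>2 \<in> {0..pi}" "t \<in> T"
  shows "summable (\<lambda>n. B n \<phi>\<^sub>1 \<phi>\<^sub>2 t $ i $ k)"
  by (intro bounded_linear.summable[OF bounded_linear_vec_nth] summable assms)

lemma longitude_series_exists:
  assumes \<phi>: "\<phi> \<in> {0..pi}" and t: "t \<in> T"
  shows "\<exists>Y. mean_square_sums M (summand \<phi> \<theta> t) Y"
proof -
  note [measurable] = summand_measurable[OF \<phi> t]
  define b where "b n = (\<Sum>i\<in>UNIV. B n \<phi> \<phi> 0 $ i $ i)" for n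
  have b: "0 \<le> b n" for n
    unfolding b_def by (intro sum_nonneg B_diagonal_nonneg \<phi>)
  have sb: "summable b"
    unfolding b_def by (intro summable_sum summable_B_component \<phi> zero_in_T)
  let ?d = "\<lambda>m n. \<integral>\<^sup>+\<omega>. ennreal ((norm ((\<Sum>l<m. summand \<phi> \<theta> t l \<omega>) - (\<Sum>l<n. summand \<phi> \<theta> t l \<omega>)))\<^sup>2) \<partial>M"
  \<comment> \<open>The squared distance of two partial sums is a block of the trace series
    \<open>b\<close>, whose Cauchy criterion therefore transfers verbatim.\<close>
  have d: "?d m n = ennreal (\<Sum>l\<in>{n..<m}. b l)" if "n \<le> m" for m n
  proof -
    have eq: "(norm ((\<Sum>l<m. summand \<phi> \<theta> t l \<omega>) - (\<Sum>l<n. summand \<phi> \<theta> t l \<omega>)))\<^sup>2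
        = (\<Sum>i\<in>UNIV. (\<Sum>l\<in>{n..<m}. summand \<phi> \<theta> t l \<omega> $ i)\<^sup>2)" for \<omega>
    proof -
      have "{..<m} - {..<n} = {n..<m}" by auto
      then have "(\<Sum>l<m. summand \<phi> \<theta> t l \<omega>) - (\<Sum>l<n. summand \<phi> \<theta> t l \<omega>) = (\<Sum>l\<in>{n..<m}. summand \<phi> \<theta> t l \<omega>)"
        using that by (subst sum_diff[symmetric]) auto
      then show ?thesis
        by (simp add: norm_vec_def L2_set_def sum_nonneg sum_component)
    qed
    have sq: "square_integrable M (\<lambda>\<omega>. \<Sum>l\<in>{n..<m}. summand \<phi> \<theta> t l \<omega> $ i)" for i
      by (intro square_integrable_sum summand_square_integrable \<phi> t)
    have "?d m n = ennreal (\<integral>\<omega>. (\<Sum>i\<in>UNIV. (\<Sum>l\<in>{n..<m}. summand \<phi> \<theta> t l \<omega> $ i)\<^sup>2) \<partial>M)"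
      unfolding eq using sq
      by (intro nn_integral_eq_integral Bochner_Integration.integrable_sum AE_I2 sum_nonneg)
        (auto simp: square_integrable_def)
    also have "(\<integral>\<omega>. (\<Sum>i\<in>UNIV. (\<Sum>l\<in>{n..<m}. summand \<phi> \<theta> t l \<omega> $ i)\<^sup>2) \<partial>M)
        = (\<Sum>i\<in>UNIV. \<Sum>l\<in>{n..<m}. B l \<phi> \<phi> 0 $ i $ i)"
      using sq \<phi> t by (subst Bochner_Integration.integral_sum)
        (auto simp: square_integrable_def summand_square_integral)
    also have "\<dots> = (\<Sum>l\<in>{n..<m}. b l)"
      unfolding b_def by (rule sum.swap)
    finally show ?thesis .
  qed
  have "\<exists>Y\<in>borel_measurable M. (\<lambda>N. \<integral>\<^sup>+\<omega>. ennreal ((norm ((\<Sum>n<N. summand \<phi> \<theta> t n \<omega>) - Y \<omega>))\<^sup>2) \<partial>M) \<longlonglongrightarrow> 0"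
  proof (rule L2_complete)
    fix e :: real assume "0 < e"
    then obtain N where "\<forall>m\<ge>N. \<forall>n. norm (\<Sum>l\<in>{m..<n}. b l) < e"
      using sb unfolding summable_Cauchy by blast
    then have N: "norm (\<Sum>l\<in>{m..<n}. b l) < e" if "N \<le> m" for m n
      using that by blast
    have le: "?d m n \<le> ennreal e" if "N \<le> n" "n \<le> m" for m n
      using d[OF that(2)] N[OF that(1), of m] by (auto intro!: ennreal_leI)
    have "?d m n \<le> ennreal e" if "N \<le> m" "N \<le> n" for m n
    proof (cases "n \<le> m")
      case True
      then show ?thesis using le that by simp
    next
      case False
      then have "?d n m \<le> ennreal e" using le that by simp
      then show ?thesis by (simp add: norm_minus_commute)
    qed
    then show "\<exists>N. \<forall>m\<ge>N. \<forall>n\<ge>N. ?d m n \<le> ennreal e" by blast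
  qed (auto intro: finite_measure_axioms)
  then show ?thesis by (auto simp: mean_square_sums_def)
qed

section \<open>Mean, covariance and remainder of an arbitrary mean square sum\<close>

context
  fixes Z :: "real \<times> real \<times> real \<Rightarrow> 'a \<Rightarrow> real ^ 'm"
  assumes Z: "is_longitude_series M T V Z"
begin

lemma Z_sums:
  assumes "\<phi> \<in> {0..pi}" "\<theta> \<in> {0..2*pi}" "t \<in> T"
  shows "mean_square_sums M (summand \<phi> \<theta> t) (Z (\<phi>, \<theta>, t))"
  using Z assms unfolding is_longitude_series_def summand_def[abs_def] by blast

lemma Z_measurable:
  "\<phi> \<in> {0..pi} \<Longrightarrow> \<theta> \<in> {0..2*pi} \<Longrightarrow> t \<in> T \<Longrightarrow> Z (\<phi>, \<theta>, t) \<in> borel_measurable M"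
  using Z_sums by (simp add: mean_square_sums_def)

lemma Z_limit:
  assumes "\<phi> \<in> {0..pi}" "\<theta> \<in> {0..2*pi}" "t \<in> T"
  shows "L2_limit M (\<lambda>N \<omega>. \<Sum>n<N. summand \<phi> \<theta> t n \<omega> $ i) (\<lambda>\<omega>. Z (\<phi>, \<theta>, t) \<omega> $ i)"
  using mean_square_sums_L2_limit[OF Z_sums summand_measurable summand_square_integrable, OF assms assms(1,3) assms(1,3)]
  by (simp only: sum_component)

lemma Z_square_integrable:
  "\<phi> \<in> {0..pi} \<Longrightarrow> \<theta> \<in> {0..2*pi} \<Longrightarrow> t \<in> T \<Longrightarrow>
    square_integrable M (\<lambda>\<omega>. Z (\<phi>, \<theta>, t) \<omega> $ i)"
  using Z_limit by (auto simp: L2_limit_def)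

lemma Z_second_order: "second_order_field M ({0..pi} \<times> {0..2*pi} \<times> T) Z"
  unfolding second_order_field_def
proof (intro ballI conjI)
  fix p assume "p \<in> {0..pi} \<times> {0..2*pi} \<times> T"
  then obtain \<phi> \<theta> t where p: "p = (\<phi>, \<theta>, t)" and *: "\<phi> \<in> {0..pi}" "\<theta> \<in> {0..2*pi}" "t \<in> T"
    by auto
  show "Z p \<in> borel_measurable M" unfolding p by (rule Z_measurable[OF *])
  have "(norm (Z p \<omega>))\<^sup>2 = (\<Sum>i\<in>UNIV. (Z p \<omega> $ i)\<^sup>2)" for \<omega>
    by (simp add: norm_vec_def L2_set_def sum_nonneg)
  then show "integrable M (\<lambda>\<omega>. (norm (Z p \<omega>))\<^sup>2)"
    using Z_square_integrable[OF *] by (simp add: square_integrable_def p)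
qed

lemma Z_mean:
  assumes *: "\<phi> \<in> {0..pi}" "\<theta> \<in> {0..2*pi}" "t \<in> T"
  shows "integral\<^sup>L M (Z (\<phi>, \<theta>, t)) = 0"
proof -
  have "square_integrable M (\<lambda>\<omega>. norm (Z (\<phi>, \<theta>, t) \<omega>))"
    using Z_second_order * measurable_compose[OF Z_measurable[OF *] borel_measurable_norm] by (auto simp: second_order_field_def square_integrable_def)
  then have int: "integrable M (Z (\<phi>, \<theta>, t))"
    by (rule integrable_norm_cancel[OF square_integrable_imp_integrable Z_measurable[OF *]])
  have "integral\<^sup>L M (Z (\<phi>, \<theta>, t)) $ i = 0" for i
  proof -
    have "(\<integral>\<omega>. (\<Sum>n<N. summand \<phi> \<theta> t n \<omega> $ i) \<partial>M) = 0" for N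
      using * by (subst Bochner_Integration.integral_sum)
        (auto simp: summand_mean_component intro!: square_integrable_imp_integrable summand_square_integrable)
    then have "(\<integral>\<omega>. Z (\<phi>, \<theta>, t) \<omega> $ i \<partial>M) = 0"
      using L2_limit_integral[OF Z_limit[OF *], of i] by (simp add: LIMSEQ_const_iff)
    moreover have "(\<integral>\<omega>. Z (\<phi>, \<theta>, t) \<omega> \<bullet> axis i 1 \<partial>M) = integral\<^sup>L M (Z (\<phi>, \<theta>, t)) \<bullet> axis i 1"
      using int by (intro integral_inner_left)
    ultimately show ?thesis by (simp add: inner_axis)
  qed
  then show ?thesis by (simp add: vec_eq_iff)
qed

lemma Z_covariance_sums:
  assumes 1: "\<phi>\<^sub>1 \<in> {0..pi}" "\<theta>\<^sub>1 \<in> {0..2*pi}" "t\<^sub>1 \<in> T"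
    and 2: "\<phi>\<^sub>2 \<in> {0..pi}" "\<theta>\<^sub>2 \<in> {0..2*pi}" "t\<^sub>2 \<in> T"
  shows "(\<lambda>n. cos (real n * (\<theta>\<^sub>1 - \<theta>\<^sub>2)) *\<^sub>R B n \<phi>\<^sub>1 \<phi>\<^sub>2 (t\<^sub>1 - t\<^sub>2)) sums
    cov_matrix M (Z (\<phi>\<^sub>1, \<theta>\<^sub>1, t\<^sub>1)) (Z (\<phi>\<^sub>2, \<theta>\<^sub>2, t\<^sub>2))"
  unfolding sums_def
proof (rule vec_tendstoI, rule vec_tendstoI)
  fix i k
  have "(\<lambda>N. \<integral>\<omega>. (\<Sum>n<N. summand \<phi>\<^sub>1 \<theta>\<^sub>1 t\<^sub>1 n \<omega> $ i) * (\<Sum>n<N. summand \<phi>\<^sub>2 \<theta>\<^sub>2 t\<^sub>2 n \<omega> $ k) \<partial>M)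
      \<longlonglongrightarrow> (\<integral>\<omega>. Z (\<phi>\<^sub>1, \<theta>\<^sub>1, t\<^sub>1) \<omega> $ i * Z (\<phi>\<^sub>2, \<theta>\<^sub>2, t\<^sub>2) \<omega> $ k \<partial>M)"
    by (intro L2_limit_integral_mult Z_limit assms)
  then show "(\<lambda>N. (\<Sum>n<N. cos (real n * (\<theta>\<^sub>1 - \<theta>\<^sub>2)) *\<^sub>R B n \<phi>\<^sub>1 \<phi>\<^sub>2 (t\<^sub>1 - t\<^sub>2)) $ i $ k)
      \<longlonglongrightarrow> cov_matrix M (Z (\<phi>\<^sub>1, \<theta>\<^sub>1, t\<^sub>1)) (Z (\<phi>\<^sub>2, \<theta>\<^sub>2, t\<^sub>2)) $ i $ k"
    using 1 2 by (simp add: summand_product_integral cov_matrix_def Z_mean sum_component)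
qed

text \<open>The remainder is the mean square limit of the blocks from order \<open>K\<close> to
  \<open>N\<close>, whose second moments are partial sums of the tail of a nonnegative series. The
  bound does not involve \<theta>. Differences appear as sums with factor -1 to fit the rules for
  limits of sums and multiples.\<close>

lemma Z_remainder_bound:
  assumes *: "\<phi> \<in> {0..pi}" "\<theta> \<in> {0..2*pi}" "t \<in> T"
  shows "square_integrable M (\<lambda>\<omega>. Z (\<phi>, \<theta>, t) \<omega> $ i - (\<Sum>n<K. summand \<phi> \<theta> t n \<omega> $ i))"
    and "(\<integral>\<omega>. (Z (\<phi>, \<theta>, t) \<omega> $ i - (\<Sum>n<K. summand \<phi> \<theta> t n \<omega> $ i))\<^sup>2 \<partial>M)
      \<le> (\<Sum>n. B (n + K) \<phi> \<phi> 0 $ i $ i)"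
proof -
  let ?S = "\<lambda>N \<omega>. \<Sum>n<N. summand \<phi> \<theta> t n \<omega> $ i"
  have sq: "square_integrable M (?S N)" for N
    using * by (intro square_integrable_sum summand_square_integrable)
  show "square_integrable M (\<lambda>\<omega>. Z (\<phi>, \<theta>, t) \<omega> $ i - ?S K \<omega>)"
    by (intro square_integrable_diff Z_square_integrable * sq)
  have lim: "L2_limit M (\<lambda>N \<omega>. ?S N \<omega> + - 1 * ?S K \<omega>) (\<lambda>\<omega>. Z (\<phi>, \<theta>, t) \<omega> $ i + - 1 * ?S K \<omega>)"
    by (intro L2_limit_add L2_limit_cmult L2_limit_const Z_limit * sq)
  have sB: "summable (\<lambda>n. B (n + K) \<phi> \<phi> 0 $ i $ i)"
    using summable_B_component[OF *(1,1) zero_in_T, of i i] by (rule summable_ignore_initial_segment)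
  have "(\<integral>\<omega>. (Z (\<phi>, \<theta>, t) \<omega> $ i + - 1 * ?S K \<omega>) * (Z (\<phi>, \<theta>, t) \<omega> $ i + - 1 * ?S K \<omega>) \<partial>M)
      \<le> (\<Sum>n. B (n + K) \<phi> \<phi> 0 $ i $ i)"
  proof (rule LIMSEQ_le_const2[OF L2_limit_integral_mult[OF lim lim]], intro exI allI impI)
    fix N assume N: "K \<le> N"
    have "?S N \<omega> + - 1 * ?S K \<omega> = (\<Sum>n\<in>{K..<N}. summand \<phi> \<theta> t n \<omega> $ i)" for \<omega>
    proof -
      have "{..<N} - {..<K} = {K..<N}" by auto
      then show ?thesis
        using N by (simp flip: sum_diff)
    qed
    then have "(\<integral>\<omega>. (?S N \<omega> + - 1 * ?S K \<omega>) * (?S N \<omega> + - 1 * ?S K \<omega>) \<partial>M)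
        = (\<Sum>n\<in>{K..<N}. B n \<phi> \<phi> 0 $ i $ i)"
      using summand_square_integral[of "{K..<N}" \<phi> t \<theta> i] * by (simp add: power2_eq_square)
    also have "\<dots> = (\<Sum>n<N - K. B (n + K) \<phi> \<phi> 0 $ i $ i)"
      using sum.shift_bounds_nat_ivl[of "\<lambda>n. B n \<phi> \<phi> 0 $ i $ i" 0 K "N - K"] N
      by (simp add: lessThan_atLeast0)
    also have "\<dots> \<le> (\<Sum>n. B (n + K) \<phi> \<phi> 0 $ i $ i)"
      by (rule sum_le_suminf[OF sB]) (auto intro: B_diagonal_nonneg *)
    finally show "(\<integral>\<omega>. (?S N \<omega> + - 1 * ?S K \<omega>) * (?S N \<omega> + - 1 * ?S K \<omega>) \<partial>M)
        \<le> (\<Sum>n. B (n + K) \<phi> \<phi> 0 $ i $ i)" .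
  qed
  then show "(\<integral>\<omega>. (Z (\<phi>, \<theta>, t) \<omega> $ i - ?S K \<omega>)\<^sup>2 \<partial>M) \<le> (\<Sum>n. B (n + K) \<phi> \<phi> 0 $ i $ i)"
    by (simp add: power2_eq_square)
qed

section \<open>Recovery of the coefficients and the Gaussian equivalence\<close>

definition fourier_coeff where
  "fourier_coeff n j \<phi> t N \<omega> = (\<Sum>k<N. ((if n = 0 then 1 else 2) / real N * trig j (real n * grid N k)) *\<^sub>R
    Z (\<phi>, grid N k, t) \<omega>)"

lemma fourier_coeff_limit:
  assumes \<phi>: "\<phi> \<in> {0..pi}" and t: "t \<in> T" and j: "j \<in> {1, 2}" and nj: "n = 0 \<longrightarrow> j = 1"
  shows "L2_limit M (\<lambda>N \<omega>. fourier_coeff n j \<phi> t N \<omega> $ i) (\<lambda>\<omega>. V n j (\<phi>, t) \<omega> $ i)"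
proof -
  define c :: real where "c = (if n = 0 then 1 else 2)"
  let ?e = "\<lambda>N k. trig j (real n * grid N k)"
  let ?S = "\<lambda>K \<theta> \<omega>. \<Sum>m<K. summand \<phi> \<theta> t m \<omega> $ i"
  \<comment> \<open>Orders m below \<open>N - n\<close> satisfy n + m < N, the range in which the
    grid functions are orthogonal.\<close>
  let ?R = "\<lambda>N k \<omega>. Z (\<phi>, grid N k, t) \<omega> $ i - ?S (N - n) (grid N k) \<omega>"
  have sqF: "square_integrable M (\<lambda>\<omega>. fourier_coeff n j \<phi> t N \<omega> $ i)" for N
    unfolding fourier_coeff_def sum_component vector_scaleR_component real_scaleR_def
    using grid_bounds[of _ N] \<phi> t
    by (intro square_integrable_sum square_integrable_cmult Z_square_integrable) auto
  have sqV: "square_integrable M (\<lambda>\<omega>. V n j (\<phi>, t) \<omega> $ i)"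
    using \<phi> t j by (intro V_square_integrable) auto
  \<comment> \<open>The condition \<open>2 * n < N\<close> says n < N - n: the truncated sum must
    still contain the order that is to be recovered.\<close>
  have bound: "(\<integral>\<omega>. (fourier_coeff n j \<phi> t N \<omega> $ i - V n j (\<phi>, t) \<omega> $ i)\<^sup>2 \<partial>M)
      \<le> 4 * (\<Sum>m. B (m + (N - n)) \<phi> \<phi> 0 $ i $ i)" if N: "2 * n < N" for N
  proof -
    have N0: "0 < real N" using N by simp
    note R = Z_remainder_bound[OF \<phi> grid_bounds t, where i = i]
    have exact: "(\<Sum>k<N. c / real N * ?e N k * ?S (N - n) (grid N k) \<omega>) = V n j (\<phi>, t) \<omega> $ i" for \<omega>
    proof -
      have "(\<Sum>k<N. c / real N * ?e N k * ?S (N - n) (grid N k) \<omega>)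
          = (\<Sum>k<N. \<Sum>m<N - n. \<Sum>l\<in>{1, 2}. (c / real N * (?e N k * trig l (real m * grid N k))) * V m l (\<phi>, t) \<omega> $ i)"
        unfolding summand_component sum_distrib_left by (simp only: mult.assoc)
      also have "\<dots> = (\<Sum>m<N - n. \<Sum>l\<in>{1, 2}. \<Sum>k<N.
          (c / real N * (?e N k * trig l (real m * grid N k))) * V m l (\<phi>, t) \<omega> $ i)"
        by (rule trans[OF sum.swap sum.cong[OF refl sum.swap]])
      also have "\<dots> = (\<Sum>m<N - n. \<Sum>l\<in>{1, 2}.
          (c / real N * (\<Sum>k<N. ?e N k * trig l (real m * grid N k))) * V m l (\<phi>, t) \<omega> $ i)"
        by (simp only: sum_distrib_left sum_distrib_right)
      also have "\<dots> = (\<Sum>m<N - n. \<Sum>l\<in>{1, 2}.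
          (if n = m \<and> j = l then 1 else 0) * V m l (\<phi>, t) \<omega> $ i)"
        unfolding c_def by (intro sum.cong refl arg_cong2[where f = times] trig_orthogonal j nj) auto
      also have "\<dots> = (\<Sum>m<N - n. if n = m then V m j (\<phi>, t) \<omega> $ i else 0)"
        using j by (intro sum.cong refl) auto
      also have "\<dots> = V n j (\<phi>, t) \<omega> $ i"
        using N by (subst sum.delta') auto
      finally show ?thesis .
    qed
    have diff: "fourier_coeff n j \<phi> t N \<omega> $ i - V n j (\<phi>, t) \<omega> $ i
        = (\<Sum>k<N. c / real N * ?e N k * ?R N k \<omega>)" for \<omega>
      by (simp add: fourier_coeff_def c_def[symmetric] sum_component exact[symmetric]
          right_diff_distrib sum_subtractf)
    have pointwise: "(fourier_coeff n j \<phi> t N \<omega> $ i - V n j (\<phi>, t) \<omega> $ i)\<^sup>2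
        \<le> (\<Sum>k<N. 4 / real N * (?R N k \<omega>)\<^sup>2)" for \<omega>
    proof -
      \<comment> \<open>Cauchy-Schwarz over the grid costs a factor \<open>N\<close>, which leaves
        \<open>1 / N\<close> of the squared weight \<open>(c / N)\<^sup>2\<close>. With
        \<open>c\<close> at most 2 the error is bounded by 4 times the grid average of the squared
        remainders, and the average of uniformly bounded terms obeys the same bound.\<close>
      have "(\<Sum>k<N. c / real N * ?e N k * ?R N k \<omega>)\<^sup>2
          \<le> (\<Sum>k<N. (c / real N * ?e N k * ?R N k \<omega>)\<^sup>2) * real N"
        using sum_squared_le_sum_of_squares[of "\<lambda>k. c / real N * ?e N k * ?R N k \<omega>" "{..<N}"]
        by simp
      also have "\<dots> = (\<Sum>k<N. (c * ?e N k)\<^sup>2 / real N * (?R N k \<omega>)\<^sup>2)"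
        unfolding sum_distrib_right
        by (intro sum.cong refl) (use N0 in \<open>simp add: power_mult_distrib power_divide, simp add: power2_eq_square\<close>)
      also have "\<dots> \<le> (\<Sum>k<N. 4 / real N * (?R N k \<omega>)\<^sup>2)"
      proof (intro sum_mono mult_right_mono divide_right_mono)
        fix k
        have "\<bar>c * ?e N k\<bar> \<le> 2 * 1"
          unfolding abs_mult by (intro mult_mono abs_trig_le_1) (auto simp: c_def)
        then show "(c * ?e N k)\<^sup>2 \<le> 4"
          using abs_le_square_iff[of "c * ?e N k" 2] by simp
      qed auto
      finally show ?thesis by (simp only: diff)
    qed
    have intR: "integrable M (\<lambda>\<omega>. (?R N k \<omega>)\<^sup>2)" if "k < N" for k
      using R(1)[OF that] by (simp add: square_integrable_def)
    have "(\<integral>\<omega>. (fourier_coeff n j \<phi> t N \<omega> $ i - V n j (\<phi>, t) \<omega> $ i)\<^sup>2 \<partial>M)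
        \<le> (\<integral>\<omega>. (\<Sum>k<N. 4 / real N * (?R N k \<omega>)\<^sup>2) \<partial>M)"
    proof (rule integral_mono[OF _ _ pointwise])
      show "integrable M (\<lambda>\<omega>. (fourier_coeff n j \<phi> t N \<omega> $ i - V n j (\<phi>, t) \<omega> $ i)\<^sup>2)"
        using square_integrable_diff[OF sqF sqV, of N] by (simp add: square_integrable_def)
      show "integrable M (\<lambda>\<omega>. \<Sum>k<N. 4 / real N * (?R N k \<omega>)\<^sup>2)"
        by (intro Bochner_Integration.integrable_sum integrable_mult_right intR) auto
    qed
    also have "\<dots> = (\<Sum>k<N. 4 / real N * (\<integral>\<omega>. (?R N k \<omega>)\<^sup>2 \<partial>M))"
      by (subst Bochner_Integration.integral_sum) (auto intro!: integrable_mult_right intR)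
    also have "\<dots> \<le> (\<Sum>k<N. 4 / real N * (\<Sum>m. B (m + (N - n)) \<phi> \<phi> 0 $ i $ i))"
      by (intro sum_mono mult_left_mono R(2)) auto
    also have "\<dots> = 4 * (\<Sum>m. B (m + (N - n)) \<phi> \<phi> 0 $ i $ i)"
      using N0 by simp
    finally show ?thesis .
  qed
  have "(\<lambda>N. \<Sum>m. B (m + N) \<phi> \<phi> 0 $ i $ i) \<longlonglongrightarrow> 0"
    by (intro suminf_exist_split2 summable_B_component \<phi> zero_in_T)
  then have "(\<lambda>N. 4 * (\<Sum>m. B (m + (N - n)) \<phi> \<phi> 0 $ i $ i)) \<longlonglongrightarrow> 4 * 0"
    by (intro tendsto_mult_left filterlim_compose[OF _ filterlim_minus_const_nat_at_top])
  then have tail: "(\<lambda>N. 4 * (\<Sum>m. B (m + (N - n)) \<phi> \<phi> 0 $ i $ i)) \<longlonglongrightarrow> 0"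
    by simp
  have "(\<lambda>N. \<integral>\<omega>. (fourier_coeff n j \<phi> t N \<omega> $ i - V n j (\<phi>, t) \<omega> $ i)\<^sup>2 \<partial>M) \<longlonglongrightarrow> 0"
    by (rule tendsto_sandwich[OF _ _ tendsto_const tail])
      (auto intro!: eventually_mono[OF eventually_gt_at_top[of "2 * n"]] bound)
  then show ?thesis using sqF sqV by (simp add: L2_limit_def)
qed

lemma gaussian_V:
  assumes G: "gaussian_field M ({0..pi} \<times> {0..2*pi} \<times> T) Z"
    and j: "j \<in> {1, 2}" and nj: "n = 0 \<longrightarrow> j = 1"
  shows "gaussian_field M I (V n j)"
  unfolding gaussian_field_def
proof (intro allI impI, elim conjE)
  fix F :: "(real \<times> real) set" and a
  assume F: "finite F" "F \<subseteq> I"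
  let ?w = "\<lambda>N k. (if n = 0 then 1 else 2) / real N * trig j (real n * grid N k)"
  show "gaussian_var M (\<lambda>\<omega>. \<Sum>p\<in>F. a p \<bullet> V n j p \<omega>)"
  proof (rule gaussian_var_L2_limit)
    show "L2_limit M (\<lambda>N \<omega>. \<Sum>p\<in>F. a p \<bullet> fourier_coeff n j (fst p) (snd p) N \<omega>)
        (\<lambda>\<omega>. \<Sum>p\<in>F. a p \<bullet> V n j p \<omega>)"
    proof (intro L2_limit_sum L2_limit_inner)
      fix p i assume "p \<in> F"
      then have "fst p \<in> {0..pi}" "snd p \<in> T" using F by auto
      from fourier_coeff_limit[OF this j nj, of i]
      show "L2_limit M (\<lambda>N \<omega>. fourier_coeff n j (fst p) (snd p) N \<omega> $ i) (\<lambda>\<omega>. V n j p \<omega> $ i)"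
        by simp
    qed
    fix N :: nat
    \<comment> \<open>Expanding the Fourier sums gives one linear combination of values of
      \<open>Z\<close>, indexed by a point of \<open>F\<close> together with a grid
      longitude.\<close>
    have "gaussian_var M (\<lambda>\<omega>. \<Sum>x\<in>F \<times> {..<N}. (?w N (snd x) *\<^sub>R a (fst x)) \<bullet>
        Z (fst (fst x), grid N (snd x), snd (fst x)) \<omega>)"
    proof (rule gaussian_field_reindex[OF G])
      show "(\<lambda>x. (fst (fst x), grid N (snd x), snd (fst x))) ` (F \<times> {..<N}) \<subseteq> {0..pi} \<times> {0..2*pi} \<times> T"
        using F(2) grid_bounds[of _ N] by fastforce
    qed (use F in auto)
    moreover have "(\<Sum>p\<in>F. a p \<bullet> fourier_coeff n j (fst p) (snd p) N \<omega>)
        = (\<Sum>x\<in>F \<times> {..<N}. (?w N (snd x) *\<^sub>R a (fst x)) \<bullet>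
          Z (fst (fst x), grid N (snd x), snd (fst x)) \<omega>)" for \<omega>
      unfolding fourier_coeff_def inner_sum_right
      by (subst sum.cartesian_product) (simp add: case_prod_unfold)
    ultimately show "gaussian_var M (\<lambda>\<omega>. \<Sum>p\<in>F. a p \<bullet> fourier_coeff n j (fst p) (snd p) N \<omega>)"
      by (simp only:)
  qed
qed

text \<open>The terms of a combination of partial sums are grouped by process (n, j) and not by
  location. Each group combines values of one Gaussian process, and distinct groups are independent;
  values of one process at different locations need not be.\<close>

lemma gaussian_Z:
  assumes G1: "\<And>n. gaussian_field M I (V n 1)" and G2: "\<And>n. 0 < n \<Longrightarrow> gaussian_field M I (V n 2)"
  shows "gaussian_field M ({0..pi} \<times> {0..2*pi} \<times> T) Z"
  unfolding gaussian_field_def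
proof (intro allI impI, elim conjE)
  fix F :: "(real \<times> real \<times> real) set" and a
  assume F: "finite F" "F \<subseteq> {0..pi} \<times> {0..2*pi} \<times> T"
  let ?pt = "\<lambda>q :: real \<times> real \<times> real. (fst q, snd (snd q))"
  let ?summand = "\<lambda>q. summand (fst q) (fst (snd q)) (snd (snd q))"
  have pt: "?pt q \<in> I" if "q \<in> F" for q using that F by auto
  show "gaussian_var M (\<lambda>\<omega>. \<Sum>q\<in>F. a q \<bullet> Z q \<omega>)"
  proof (rule gaussian_var_L2_limit)
    show "L2_limit M (\<lambda>N \<omega>. \<Sum>q\<in>F. a q \<bullet> (\<Sum>n<N. ?summand q n \<omega>)) (\<lambda>\<omega>. \<Sum>q\<in>F. a q \<bullet> Z q \<omega>)"
    proof (intro L2_limit_sum L2_limit_inner)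
      fix q i assume "q \<in> F"
      then have "fst q \<in> {0..pi}" "fst (snd q) \<in> {0..2*pi}" "snd (snd q) \<in> T" using F by auto
      from Z_limit[OF this, of i]
      show "L2_limit M (\<lambda>N \<omega>. (\<Sum>n<N. ?summand q n \<omega>) $ i) (\<lambda>\<omega>. Z q \<omega> $ i)"
        by (simp add: sum_component)
    qed
    fix N :: nat
    let ?K = "{..<N} \<times> {1, 2 :: nat}"
    let ?b = "\<lambda>u q. trig (snd u) (real (fst u) * fst (snd q)) *\<^sub>R a q"
    define Y :: "nat \<times> nat \<Rightarrow> (real \<times> real \<Rightarrow> real ^ 'm) \<Rightarrow> real"
      where "Y u x = (\<Sum>q\<in>F. ?b u q \<bullet> x (?pt q))" for u x
    have Y: "Y u (\<lambda>p\<in>I. V (fst u) (snd u) p \<omega>) = (\<Sum>q\<in>F. ?b u q \<bullet> V (fst u) (snd u) (?pt q) \<omega>)"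
      for u \<omega>
      using pt by (auto simp: Y_def intro!: sum.cong)
    have "gaussian_var M (\<lambda>\<omega>. \<Sum>u\<in>?K. Y u (\<lambda>p\<in>I. V (fst u) (snd u) p \<omega>))"
    proof (rule gaussian_var_sum_indep)
      show "indep_vars (\<lambda>_. borel) (\<lambda>u \<omega>. Y u (\<lambda>p\<in>I. V (fst u) (snd u) p \<omega>)) ?K"
      proof (rule indep_functionals)
        show "Y u \<in> borel_measurable (PiM I (\<lambda>_. borel))" for u
          unfolding Y_def[abs_def]
          using pt by (intro borel_measurable_sum borel_measurable_inner measurable_component_singleton) auto
      qed auto
      fix u assume "u \<in> ?K"
      show "gaussian_var M (\<lambda>\<omega>. Y u (\<lambda>p\<in>I. V (fst u) (snd u) p \<omega>))"
      \<comment> \<open>The factor \<open>sin 0 = 0\<close> annihilates the contribution of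
        \<open>V 0 2\<close>, for which no Gaussian assumption is made; what remains is the constant
        0.\<close>
      proof (cases "u = (0, 2)")
        case True
        then show ?thesis unfolding Y by (simp add: trig_def gaussian_var_zero)
      next
        case False
        then have "gaussian_field M I (V (fst u) (snd u))"
          using \<open>u \<in> ?K\<close> G1 G2 by (cases u) auto
        then show ?thesis
          unfolding Y using pt F(1) by (intro gaussian_field_reindex) auto
      qed
    qed
    moreover have "(\<Sum>q\<in>F. a q \<bullet> (\<Sum>n<N. ?summand q n \<omega>)) = (\<Sum>u\<in>?K. Y u (\<lambda>p\<in>I. V (fst u) (snd u) p \<omega>))" for \<omega>
    proof -
      have summand: "?summand q n \<omega> = (\<Sum>j\<in>{1, 2}. trig j (real n * fst (snd q)) *\<^sub>R V n j (?pt q) \<omega>)" for q n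
        by (simp add: summand_def trig_def)
      have "(\<Sum>n<N. ?summand q n \<omega>) = (\<Sum>u\<in>?K. trig (snd u) (real (fst u) * fst (snd q)) *\<^sub>R V (fst u) (snd u) (?pt q) \<omega>)" for q
        unfolding summand by (subst sum.cartesian_product) (simp add: case_prod_unfold)
      then show ?thesis
        unfolding Y by (subst sum.swap) (simp add: inner_sum_right)
    qed
    ultimately show "gaussian_var M (\<lambda>\<omega>. \<Sum>q\<in>F. a q \<bullet> (\<Sum>n<N. ?summand q n \<omega>))"
      by (simp only:)
  qed
qed

section \<open>Dependence on the point of the sphere, and longitudinal reversibility\<close>

lemma sphere_time_field_Z: "sphere_time_field M T Z"
  unfolding sphere_time_field_def
proof (intro conjI ballI impI Z_second_order)
  fix \<phi>\<^sub>1 \<phi>\<^sub>2 \<theta>\<^sub>1 \<theta>\<^sub>2 t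
  assume \<phi>: "\<phi>\<^sub>1 \<in> {0<..<pi}" "\<phi>\<^sub>2 \<in> {0<..<pi}"
    and \<theta>: "\<theta>\<^sub>1 \<in> {0..2*pi}" "\<theta>\<^sub>2 \<in> {0..2*pi}" and t: "t \<in> T"
    and eq: "sphere_point \<phi>\<^sub>1 \<theta>\<^sub>1 = sphere_point \<phi>\<^sub>2 \<theta>\<^sub>2"
  have comps: "sin \<phi>\<^sub>1 * cos \<theta>\<^sub>1 = sin \<phi>\<^sub>2 * cos \<theta>\<^sub>2" "sin \<phi>\<^sub>1 * sin \<theta>\<^sub>1 = sin \<phi>\<^sub>2 * sin \<theta>\<^sub>2"
    "cos \<phi>\<^sub>1 = cos \<phi>\<^sub>2"
    using eq by (auto simp: sphere_point_def vec_eq_iff forall_3)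
  have \<phi>eq: "\<phi>\<^sub>1 = \<phi>\<^sub>2" using cos_inj_pi[OF _ _ _ _ comps(3)] \<phi> by auto
  \<comment> \<open>Away from the poles the longitude is determined modulo 2 pi, and so are its
    integer multiples. Equal points therefore have identical series, and mean square limits are
    unique almost surely.\<close>
  have "sin \<phi>\<^sub>2 \<noteq> 0" using \<phi> sin_gt_zero[of \<phi>\<^sub>2] by auto
  then have "cis \<theta>\<^sub>1 = cis \<theta>\<^sub>2" using comps \<phi>eq by (simp add: complex_eq_iff)
  then have "cis (real n * \<theta>\<^sub>1) = cis (real n * \<theta>\<^sub>2)" for n
    by (metis Complex.DeMoivre)
  then have "summand \<phi>\<^sub>1 \<theta>\<^sub>1 t = summand \<phi>\<^sub>2 \<theta>\<^sub>2 t"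
    by (intro ext) (simp add: summand_def \<phi>eq complex_eq_iff)
  then have "AE \<omega> in M. Z (\<phi>\<^sub>1, \<theta>\<^sub>1, t) \<omega> $ i = Z (\<phi>\<^sub>2, \<theta>\<^sub>2, t) \<omega> $ i" for i
    using Z_limit[of \<phi>\<^sub>1 \<theta>\<^sub>1 t i] Z_limit[of \<phi>\<^sub>2 \<theta>\<^sub>2 t i] \<phi> \<theta> t
    by (intro L2_limit_unique) auto
  then have "AE \<omega> in M. \<forall>i\<in>UNIV. Z (\<phi>\<^sub>1, \<theta>\<^sub>1, t) \<omega> $ i = Z (\<phi>\<^sub>2, \<theta>\<^sub>2, t) \<omega> $ i"
    by (intro AE_finite_allI) auto
  then show "AE \<omega> in M. Z (\<phi>\<^sub>1, \<theta>\<^sub>1, t) \<omega> = Z (\<phi>\<^sub>2, \<theta>\<^sub>2, t) \<omega>"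
    by eventually_elim (simp add: vec_eq_iff)
qed

lemma Z_axial_covariance:
  "has_axial_covariance M T Z (\<lambda>\<phi>\<^sub>1 \<phi>\<^sub>2 \<theta> t. \<Sum>n. cos (real n * \<theta>) *\<^sub>R B n \<phi>\<^sub>1 \<phi>\<^sub>2 t)"
  unfolding has_axial_covariance_def by (intro ballI sums_unique Z_covariance_sums)

lemma longitudinally_reversible_Z: "longitudinally_reversible_stationary M T Z"
  unfolding longitudinally_reversible_stationary_def axially_symmetric_stationary_def
proof (intro conjI exI)
  show "sphere_time_field M T Z" by (rule sphere_time_field_Z)
  show "\<forall>\<phi>\<in>{0..pi}. \<forall>\<theta>\<in>{0..2*pi}. \<forall>t\<in>T. integral\<^sup>L M (Z (\<phi>, \<theta>, t)) = (\<lambda>_. 0) \<phi>"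
    by (simp add: Z_mean)
\<comment> \<open>One function witnesses both existence claims; its symmetry in \<theta> is the
  evenness of the cosine.\<close>
qed (rule Z_axial_covariance, rule Z_axial_covariance, simp)

lemma covariance_series_summable:
  assumes "\<phi>\<^sub>1 \<in> {0..pi}" "\<phi>\<^sub>2 \<in> {0..pi}" "\<theta> \<in> {-2*pi..2*pi}" "t \<in> T"
  shows "summable (\<lambda>n. cos (real n * \<theta>) *\<^sub>R B n \<phi>\<^sub>1 \<phi>\<^sub>2 t)"
proof -
  \<comment> \<open>The positive and negative parts of \<theta> are two longitudes in [0, 2 pi] with
    difference \<theta>. With the times \<open>t\<close> and 0 they make the series that of a
    covariance of \<open>Z\<close>, which is known to converge.\<close>
  have "max \<theta> 0 - max (- \<theta>) 0 = \<theta>" by auto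
  then show ?thesis
    using Z_covariance_sums[of \<phi>\<^sub>1 "max \<theta> 0" t \<phi>\<^sub>2 "max (- \<theta>) 0" 0] assms zero_in_T
    by (auto intro: sums_summable)
qed

end

end

theorem theorem6:
  fixes M :: "'a measure"
    and T :: "real set"
    and V :: "nat \<Rightarrow> nat \<Rightarrow> real \<times> real \<Rightarrow> 'a \<Rightarrow> real ^ 'm"
    and B :: "nat \<Rightarrow> real \<Rightarrow> real \<Rightarrow> real \<Rightarrow> real ^ 'm ^ 'm"
  assumes "prob_space M"
    and "T = UNIV \<or> T = \<int>"
    and "\<And>n j. j \<in> {1, 2} \<Longrightarrow> second_order_field M ({0..pi} \<times> T) (V n j)"
    and "\<And>n j \<phi> t. j \<in> {1, 2} \<Longrightarrow> \<phi> \<in> {0..pi} \<Longrightarrow> t \<in> T \<Longrightarrow> integral\<^sup>L M (V n j (\<phi>, t)) = 0"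
    and "\<And>n j \<phi>\<^sub>1 \<phi>\<^sub>2 t\<^sub>1 t\<^sub>2. j \<in> {1, 2} \<Longrightarrow> \<phi>\<^sub>1 \<in> {0..pi} \<Longrightarrow> \<phi>\<^sub>2 \<in> {0..pi} \<Longrightarrow>
           t\<^sub>1 \<in> T \<Longrightarrow> t\<^sub>2 \<in> T \<Longrightarrow>
           cov_matrix M (V n j (\<phi>\<^sub>1, t\<^sub>1)) (V n j (\<phi>\<^sub>2, t\<^sub>2)) = B n \<phi>\<^sub>1 \<phi>\<^sub>2 (t\<^sub>1 - t\<^sub>2)"
    and "independent_processes M ({0..pi} \<times> T) (\<lambda>(n, j). V n j) (UNIV \<times> {1, 2})"
    and "\<And>\<phi>\<^sub>1 \<phi>\<^sub>2 t. \<phi>\<^sub>1 \<in> {0..pi} \<Longrightarrow> \<phi>\<^sub>2 \<in> {0..pi} \<Longrightarrow> t \<in> T \<Longrightarrow>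
           summable (\<lambda>n. B n \<phi>\<^sub>1 \<phi>\<^sub>2 t)"
  shows "(\<exists>Z. is_longitude_series M T V Z) \<and>
    (\<forall>Z. is_longitude_series M T V Z \<longrightarrow>
       longitudinally_reversible_stationary M T Z \<and>
       (\<forall>\<phi>\<in>{0..pi}. \<forall>\<theta>\<in>{0..2*pi}. \<forall>t\<in>T. integral\<^sup>L M (Z (\<phi>, \<theta>, t)) = 0) \<and>
       (\<forall>\<phi>\<^sub>1\<in>{0..pi}. \<forall>\<phi>\<^sub>2\<in>{0..pi}. \<forall>\<theta>\<in>{-2*pi..2*pi}. \<forall>t\<in>T.
          summable (\<lambda>n. cos (real n * \<theta>) *\<^sub>R B n \<phi>\<^sub>1 \<phi>\<^sub>2 t)) \<and>
       has_axial_covariance M T Z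
         (\<lambda>\<phi>\<^sub>1 \<phi>\<^sub>2 \<theta> t. \<Sum>n. cos (real n * \<theta>) *\<^sub>R B n \<phi>\<^sub>1 \<phi>\<^sub>2 t) \<and>
       (gaussian_field M ({0..pi} \<times> {0..2*pi} \<times> T) Z \<longleftrightarrow>
          (\<forall>n. gaussian_field M ({0..pi} \<times> T) (V n 1) \<and>
               (0 < n \<longrightarrow> gaussian_field M ({0..pi} \<times> T) (V n 2)))))"
proof -
  interpret longitude_model M T V B
    using assms by (intro longitude_model.intro longitude_model_axioms.intro)
  have series: "is_longitude_series M T V Z \<longleftrightarrow>
      (\<forall>\<phi>\<in>{0..pi}. \<forall>\<theta>\<in>{0..2*pi}. \<forall>t\<in>T. mean_square_sums M (summand \<phi> \<theta> t) (Z (\<phi>, \<theta>, t)))" for Z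
    by (simp add: is_longitude_series_def summand_def[abs_def])
  \<comment> \<open>A limit may be chosen separately at each coordinate triple, since
    \<open>is_longitude_series\<close> relates no two of them.\<close>
  have "mean_square_sums M (summand \<phi> \<theta> t) (SOME Y. mean_square_sums M (summand \<phi> \<theta> t) Y)"
    if "\<phi> \<in> {0..pi}" "t \<in> T" for \<phi> \<theta> t
    by (rule someI_ex[OF longitude_series_exists[OF that]])
  then have ex: "is_longitude_series M T V (\<lambda>(\<phi>, \<theta>, t). SOME Y. mean_square_sums M (summand \<phi> \<theta> t) Y)"
    unfolding series by simp
  show ?thesis
  proof (intro conjI allI impI)
    show "\<exists>Z. is_longitude_series M T V Z"
      by (intro exI) (fact ex)
    fix Z assume Z: "is_longitude_series M T V Z"
    show "longitudinally_reversible_stationary M T Z"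
      by (rule longitudinally_reversible_Z[OF Z])
    show "\<forall>\<phi>\<in>{0..pi}. \<forall>\<theta>\<in>{0..2*pi}. \<forall>t\<in>T. integral\<^sup>L M (Z (\<phi>, \<theta>, t)) = 0"
      by (intro ballI Z_mean[OF Z])
    show "\<forall>\<phi>\<^sub>1\<in>{0..pi}. \<forall>\<phi>\<^sub>2\<in>{0..pi}. \<forall>\<theta>\<in>{-2*pi..2*pi}. \<forall>t\<in>T.
        summable (\<lambda>n. cos (real n * \<theta>) *\<^sub>R B n \<phi>\<^sub>1 \<phi>\<^sub>2 t)"
      by (intro ballI covariance_series_summable[OF Z])
    show "has_axial_covariance M T Z
        (\<lambda>\<phi>\<^sub>1 \<phi>\<^sub>2 \<theta> t. \<Sum>n. cos (real n * \<theta>) *\<^sub>R B n \<phi>\<^sub>1 \<phi>\<^sub>2 t)"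
      by (rule Z_axial_covariance[OF Z])
    show "gaussian_field M ({0..pi} \<times> {0..2*pi} \<times> T) Z \<longleftrightarrow>
        (\<forall>n. gaussian_field M I (V n 1) \<and> (0 < n \<longrightarrow> gaussian_field M I (V n 2)))"
      using gaussian_V[OF Z, of 1] gaussian_V[OF Z, of 2] gaussian_Z[OF Z] by auto
  qed
qed

end
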